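(* Let $2\le p<\infty$. There exists a constant $C$ such that for every family $\{I_k\}$ of pairwise disjoint generalized intervals in $\mathbb{Z}_+$ with respect to the partial order $\preceq$ on $\mathbb{Z}_+$ obtained by transporting the coordinatewise partial order of $\mathbb{Z}_+\times\mathbb{Z}_+$ via the digit-interleaving bijection $\Psi:\mathbb{Z}_+\times\mathbb{Z}_+\to\mathbb{Z}_+$, and every $f\in L^p[0,1)$, $$\Big\|\Big(\sum_k|M_{I_k}f|^2\Big)^{1/2}\Big\|_{L^p[0,1)}\le C\,\|f\|_{L^p[0,1)}.$$
   Context: $\mathbb{Z}_+=\{0,1,2,\dots\}$. Walsh functions: for $x=\sum_{k\ge1}x_k2^{-k}\in[0,1)$, $x_k\in\{0,1\}$ (if there are two expansions, the one with $x_k\to0$), and $n=\sum_{k\ge1}n_k2^{k-1}\in\mathbb{Z}_+$, $n_k\in\{0,1\}$, set $w_n(x)=\prod_{k\ge1}(-1)^{x_kn_k}$. For a finite set $I\subseteq\mathbb{Z}_+$, $M_If=\sum_{n\in I}\langle f,w_n\rangle w_n$, where $\langle f,w_n\rangle=\int_0^1f\,w_n$. The bijection $\Psi$: for $n=\sum_{k\ge1}n_k2^{k-1}$ and $m=\sum_{k\ge1}m_k2^{k-1}$ with binary digits $n_k,m_k\in\{0,1\}$, $\Psi(n,m)=\sum_{k\ge1}l_k2^{k-1}$, where $l_{2j-1}=n_j$ and $l_{2j}=m_j$ for $j\ge1$. The partial order $\preceq$ is defined by $\Psi(n,m)\preceq\Psi(n',m')$ iff $n\le n'$ and $m\le m'$.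 A generalized interval is a set $[a,b]=\{x\in\mathbb{Z}_+:a\preceq x\preceq b\}$, $a,b\in\mathbb{Z}_+$; equivalently, the image under $\Psi$ of a rectangle $[n,n']\times[m,m']\subseteq\mathbb{Z}_+^2$. *)

theory Defs
  imports "HOL-Analysis.Analysis"
begin

text \<open>
  Binary digits are numbered from \<open>k = 1\<close>: \<open>n = \<Sum>k\<ge>1. nat_digit n k * 2 ^ (k - 1)\<close> and,
  for \<open>x \<in> {0..<1}\<close>, \<open>x = \<Sum>k\<ge>1. real_digit x k * 2 powr - k\<close>.  Taking floors selects, for dyadic
  rationals, the expansion that ends in zeros.
\<close>

definition nat_digit :: "nat \<Rightarrow> nat \<Rightarrow> nat" where
  "nat_digit n k = of_bool (bit n (k - 1))"

definition real_digit :: "real \<Rightarrow> nat \<Rightarrow> nat" where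
  "real_digit x k = nat (\<lfloor>2 ^ k * x\<rfloor> mod 2)"

text \<open>The digits of \<open>n\<close> with index \<open>k > n\<close> vanish, so the product may stop at \<open>k = n\<close>.\<close>

definition walsh :: "nat \<Rightarrow> real \<Rightarrow> real" where
  "walsh n x = (\<Prod>k=1..n. (-1) ^ (real_digit x k * nat_digit n k))"

definition walsh_coeff :: "(real \<Rightarrow> complex) \<Rightarrow> nat \<Rightarrow> complex" where
  "walsh_coeff f n = (LINT x|lebesgue_on {0..<1}. f x * of_real (walsh n x))"

definition walsh_mult :: "nat set \<Rightarrow> (real \<Rightarrow> complex) \<Rightarrow> real \<Rightarrow> complex" where
  "walsh_mult I f x = (\<Sum>n\<in>I. walsh_coeff f n * of_real (walsh n x))"

definition interleave_digit :: "nat \<Rightarrow> nat \<Rightarrow> nat \<Rightarrow> nat" where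
  "interleave_digit n m k = (if odd k then nat_digit n ((k + 1) div 2) else nat_digit m (k div 2))"

text \<open>The interleaved digits with index \<open>k > 2 * max n m\<close> vanish.\<close>

definition interleave :: "nat \<Rightarrow> nat \<Rightarrow> nat" where
  "interleave n m = (\<Sum>k=1..2 * max n m. interleave_digit n m k * 2 ^ (k - 1))"

lemma nat_digit_eq_0: "n < k \<Longrightarrow> nat_digit n k = 0"
  unfolding nat_digit_def
  by (simp add: bit_iff_odd)
    (metis Suc_pred div_less even_zero gr0I le_less_trans less_Suc_eq_le less_exp less_zeroE)

lemma sum_digits_eq_horner_sum:
  "(\<Sum>k=1..N. of_bool (P k) * 2 ^ (k - 1)) =
     horner_sum of_bool (2::nat) (map (\<lambda>i. P (Suc i)) [0..<N])"
  unfolding horner_sum_eq_sum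
  by (rule sum.reindex_bij_witness[of _ Suc "\<lambda>k. k - 1"]) auto

lemma bit_interleave:
  "bit (interleave n m) i = (if even i then bit n (i div 2) else bit m (i div 2))"
proof -
  let ?P = "\<lambda>k. if odd k then bit n ((k + 1) div 2 - 1) else bit m (k div 2 - 1)"
  have d: "interleave_digit n m k = of_bool (?P k)" for k
    by (auto simp: interleave_digit_def nat_digit_def)
  have "interleave n m = horner_sum of_bool (2::nat) (map (\<lambda>i. ?P (Suc i)) [0..<2 * max n m])"
    unfolding interleave_def d sum_digits_eq_horner_sum ..
  hence *: "bit (interleave n m) i = (i < 2 * max n m \<and> ?P (Suc i))"
    by (auto simp: bit_horner_sum_bit_iff)
  have z: "\<not> bit a j" if "j \<ge> a" for a j :: nat
    using nat_digit_eq_0[of a "Suc j"] that by (simp add: nat_digit_def)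
  have e: "i \<ge> 2 * max n m \<Longrightarrow> i div 2 \<ge> n \<and> i div 2 \<ge> m"
    by auto
  show ?thesis
    using * z e by (cases "even i") (auto simp: not_less elim!: oddE evenE)
qed

lemma interleave_inject: "interleave n m = interleave n' m' \<Longrightarrow> n = n' \<and> m = m'"
proof (intro conjI; rule bit_eqI)
  fix i
  assume a: "interleave n m = interleave n' m'"
  show "bit n i = bit n' i"
    using bit_interleave[of n m "2 * i"] bit_interleave[of n' m' "2 * i"] a by simp
  show "bit m i = bit m' i"
    using bit_interleave[of n m "2 * i + 1"] bit_interleave[of n' m' "2 * i + 1"] a by simp
qed

lemma bij_interleave: "bij (\<lambda>(n, m). interleave n m)"
proof (rule bijI)
  show "inj (\<lambda>(n, m). interleave n m)"
    by (auto intro!: injI dest: interleave_inject)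
  have "\<exists>n m. l = interleave n m" for l
  proof -
    have z: "\<not> bit l j" if "j \<ge> l" for j
      using nat_digit_eq_0[of l "Suc j"] that by (simp add: nat_digit_def)
    define n where "n = horner_sum of_bool (2::nat) (map (\<lambda>i. bit l (2 * i)) [0..<l])"
    define m where "m = horner_sum of_bool (2::nat) (map (\<lambda>i. bit l (2 * i + 1)) [0..<l])"
    have n: "bit n i = bit l (2 * i)" for i
      using z[of "2 * i"] by (cases "i < l") (auto simp: n_def bit_horner_sum_bit_iff)
    have m: "bit m i = bit l (2 * i + 1)" for i
      using z[of "2 * i + 1"] by (cases "i < l") (auto simp: m_def bit_horner_sum_bit_iff)
    have "l = interleave n m"
      by (rule bit_eqI) (auto simp: bit_interleave n m)
    thus ?thesis
      by blast
  qed
  thus "surj (\<lambda>(n, m). interleave n m)"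
    by (force simp: surj_def)
qed

definition preceq :: "nat \<Rightarrow> nat \<Rightarrow> bool" (infix \<open>\<preceq>\<close> 50) where
  "a \<preceq> b \<longleftrightarrow> (\<exists>n m n' m'. a = interleave n m \<and> b = interleave n' m' \<and> n \<le> n' \<and> m \<le> m')"

definition generalized_interval :: "nat set \<Rightarrow> bool" where
  "generalized_interval I \<longleftrightarrow> (\<exists>a b. I = {x. a \<preceq> x \<and> x \<preceq> b})"

lemma finite_generalized_interval:
  assumes "generalized_interval I"
  shows "finite I"
proof -
  obtain a b where I: "I = {x. a \<preceq> x \<and> x \<preceq> b}"
    using assms by (auto simp: generalized_interval_def)
  show ?thesis
  proof (cases "\<exists>n m. b = interleave n m")
    case True
    then obtain n m where b: "b = interleave n m"
      by auto
    have "I \<subseteq> (\<lambda>(u, v). interleave u v) ` ({..n} \<times> {..m})"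
      unfolding I preceq_def b by (auto dest!: interleave_inject)
    thus ?thesis
      by (rule finite_subset) auto
  qed (simp add: I preceq_def)
qed

text \<open>
  \<open>L\<^sup>p\<close> norms are taken in \<open>[0, \<infinity>]\<close>, so that the pointwise infinite sum in the square function
  needs no convergence hypothesis.  Only exponents \<open>a > 0\<close> are used below.
\<close>

definition ennreal_powr :: "ennreal \<Rightarrow> real \<Rightarrow> ennreal" where
  "ennreal_powr t a = (if t = \<infinity> then \<infinity> else ennreal (enn2real t powr a))"

definition Lp_norm :: "real \<Rightarrow> (real \<Rightarrow> ennreal) \<Rightarrow> ennreal" where
  "Lp_norm p g =
     ennreal_powr (\<integral>\<^sup>+ x. ennreal_powr (g x) p \<partial>lebesgue_on {0..<1}) (1 / p)"

definition in_Lp :: "real \<Rightarrow> (real \<Rightarrow> complex) \<Rightarrow> bool" where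
  "in_Lp p f \<longleftrightarrow>
     f \<in> borel_measurable (lebesgue_on {0..<1}) \<and> Lp_norm p (\<lambda>x. ennreal (cmod (f x))) < \<infinity>"

definition square_function ::
    "nat set \<Rightarrow> (nat \<Rightarrow> nat set) \<Rightarrow> (real \<Rightarrow> complex) \<Rightarrow> real \<Rightarrow> ennreal" where
  "square_function K I f x =
     ennreal_powr (\<Sum>\<^sub>\<infinity>k\<in>K. ennreal ((cmod (walsh_mult (I k) f x))\<^sup>2)) (1 / 2)"

end

theory Submission
  imports Defs
begin

text \<open>
  Splitting the digits of \<open>x \<in> {0..<1}\<close> alternately between two coordinates turns the Walsh functions
  with interleaved indices into products of two Walsh functions, and generalized intervals into
  rectangles (\<open>walsh_interleave\<close>).  The theorem is therefore the two-parameter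
  Littlewood--Paley--Rubio de Francia inequality for the Walsh system.  For finitely many rectangles
  everything depends on finitely many digits, so it is a statement about functions on the grid of pairs
  of numbers below \<open>2 ^ N\<close>, with a constant independent of \<open>N\<close>.

  There are two ingredients.  The first reduces rectangles to dyadic ones.  An interval is a union of at
  most two families of dyadic shells around its endpoints (\<open>interval_shells_exist\<close>); modulated by the
  Walsh function of the endpoint, the pieces of a function with frequencies in these shells are the
  differences of a dyadic martingale.  The vector-valued Burkholder inequality
  \<open>burkholder_inequality\<close>, valid with modulations because these have modulus one, bounds the square
  function of the rectangles by that of the products of shells; it is applied in one variable at a
  time.

  The second ingredient treats pairwise disjoint dyadic rectangles \<open>Q\<close> by a weighted estimate
  (\<open>dyadic_square_sum_weighted\<close>): the sum of \<open>|M\<^sub>Q F|\<^sup>2 g\<close> over \<open>Q\<close> and over the grid is at most the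
  sum of \<open>|F|\<^sup>2\<close> times the strong maximal function of \<open>g\<close>.  The multiplier of a dyadic rectangle is local and its modulus is
  locally constant, so on every level set of the maximal function this is Bessel's inequality for the
  restriction of \<open>F\<close> to that set, whatever its shape.  The strong maximal function is bounded on
  \<open>L\<^sup>q\<close> for every \<open>q > 1\<close> by iterating Doob's inequality.  Choosing for \<open>g\<close> a power of the square
  function itself gives the \<open>L\<^sup>p\<close> bound for \<open>p > 2\<close>.

  All sums on the grid being finite, Young's inequality with absorption replaces every use of duality.
\<close>

section \<open>Inequalities for real powers\<close>

text \<open>
  The convex function \<open>x powr q\<close> lies above its tangents: this is Young's
  inequality for \<open>b\<close> and \<open>a powr (q - 1)\<close>.
\<close>

lemma powr_tangent:
  fixes q a b :: real
  assumes "1 \<le> q" "0 \<le> a" "0 \<le> b"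
  shows "q * b * a powr (q - 1) \<le> b powr q + (q - 1) * a powr q"
proof (cases "a = 0 \<or> b = 0")
  case True
  thus ?thesis using assms by auto
next
  case False
  hence "a > 0" "b > 0" using assms by auto
  have "(b powr q) powr (1 / q) * (a powr q) powr (1 - 1 / q)
      \<le> (1 / q) * b powr q + (1 - 1 / q) * a powr q"
    using assms \<open>a > 0\<close> \<open>b > 0\<close> by (intro Youngs_inequality_0) auto
  also have "(b powr q) powr (1 / q) = b"
    using assms \<open>b > 0\<close> by (simp add: powr_powr)
  also have "(a powr q) powr (1 - 1 / q) = a powr (q - 1)"
    using assms by (simp add: powr_powr algebra_simps)
  finally have "q * (b * a powr (q - 1)) \<le> q * ((1 / q) * b powr q + (1 - 1 / q) * a powr q)"
    using assms by (intro mult_left_mono) auto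
  also have "\<dots> = b powr q + (q - 1) * a powr q"
    using assms by (simp add: field_simps)
  finally show ?thesis by (simp add: mult.assoc)
qed

text \<open>
  Young's inequality with a small constant \<open>e\<close>.  Each estimate below that controls a quantity by a
  mixture of itself and of the desired bound is closed by absorbing the \<open>e\<close>-term into the left-hand
  side; all sums are finite, so this is legitimate.
\<close>

lemma powr_mult_absorb:
  fixes a b e :: real
  assumes "0 \<le> a" "0 < b" "0 < e"
  shows "\<exists>C\<ge>0. \<forall>x y. 0 \<le> x \<longrightarrow> 0 \<le> y \<longrightarrow>
           x powr a * y powr b \<le> e * x powr (a + b) + C * y powr (a + b)"
proof -
  \<comment> \<open>The threshold for \<open>x / y\<close> beyond which the \<open>e\<close>-term alone dominates.\<close>
  define K where "K = (1 / e) powr (1 / b)"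
  have K: "K > 0" "K powr b = 1 / e"
    using assms by (auto simp: K_def powr_powr)
  have "x powr a * y powr b \<le> e * x powr (a + b) + K powr a * y powr (a + b)"
    if "0 \<le> x" "0 \<le> y" for x y
  proof (cases "x \<ge> K * y")
    case True
    have "(K * y) powr b \<le> x powr b"
      using True K assms that by (intro powr_mono2) auto
    hence "y powr b \<le> e * x powr b"
      using K that assms by (simp add: powr_mult field_simps)
    hence "x powr a * y powr b \<le> x powr a * (e * x powr b)"
      by (intro mult_left_mono) auto
    also have "\<dots> = e * x powr (a + b)" by (simp add: powr_add)
    finally show ?thesis by (smt (verit) mult_nonneg_nonneg powr_ge_zero)
  next
    case False
    have "x powr a \<le> (K * y) powr a"
      using False assms that by (intro powr_mono2) auto
    hence "x powr a * y powr b \<le> (K * y) powr a * y powr b"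
      by (intro mult_right_mono) auto
    also have "\<dots> = K powr a * y powr (a + b)"
      using K that by (simp add: powr_mult powr_add)
    finally show ?thesis using assms by (smt (verit) mult_nonneg_nonneg powr_ge_zero)
  qed
  thus ?thesis by (intro exI[of _ "K powr a"]) auto
qed

text \<open>
  A quadratic upper Taylor bound at \<open>1\<close>.  For \<open>r < 2\<close> the second derivative of \<open>z powr r\<close> is unbounded
  near \<open>0\<close>.  The tangent at \<open>z\<close> leaves a multiple of \<open>(z - 1) * (z powr (r - 1) - 1)\<close> as error term,
  which is quadratic by a Lipschitz estimate at \<open>1\<close>.  The range up to \<open>4\<close> covers the quotients
  \<open>|x + d|\<^sup>2 / |x|\<^sup>2\<close> for \<open>|d| \<le> |x|\<close>.
\<close>

lemma powr_second_order:
  fixes r :: real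
  assumes "1 \<le> r"
  shows "\<exists>C\<ge>0. \<forall>z. 0 \<le> z \<longrightarrow> z \<le> 4 \<longrightarrow> z powr r \<le> 1 + r * (z - 1) + C * (z - 1)\<^sup>2"
proof -
  define s where "s = r - 1"
  have s: "s \<ge> 0" using assms by (simp add: s_def)
  define D where "D = max (s * 4 powr s) (max 1 s)"
  have main: "(z - 1) * (z powr s - 1) \<le> D * (z - 1)\<^sup>2" if z: "0 < z" "z \<le> 4" for z
  proof (cases "z \<ge> 1")
    case True
    have "1 + - (s * ln z) \<le> exp (- (s * ln z))" by (rule exp_ge_add_one_self)
    hence "z powr s * (1 - s * ln z) \<le> z powr s * exp (- (s * ln z))"
      by (intro mult_left_mono) auto
    also have "\<dots> = 1" using z by (simp add: powr_def exp_minus)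
    finally have "z powr s - 1 \<le> z powr s * (s * ln z)" by (simp add: algebra_simps)
    also have "\<dots> \<le> 4 powr s * (s * (z - 1))"
      using z s True ln_le_minus_one[of z]
      by (intro mult_mono powr_mono2) auto
    also have "\<dots> = (s * 4 powr s) * (z - 1)" by simp
    also have "\<dots> \<le> D * (z - 1)" using True by (intro mult_right_mono) (auto simp: D_def)
    finally have "(z - 1) * (z powr s - 1) \<le> (z - 1) * (D * (z - 1))"
      using True by (intro mult_left_mono) auto
    thus ?thesis by (simp add: power2_eq_square algebra_simps)
  next
    case False
    define q where "q = max 1 s"
    have "q * z * 1 powr (q - 1) \<le> z powr q + (q - 1) * 1 powr q"
      using z by (intro powr_tangent) (auto simp: q_def)
    moreover have "z powr q \<le> z powr s"
      using False z by (intro powr_mono') (auto simp: q_def)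
    ultimately have "1 - z powr s \<le> q * (1 - z)" by (simp add: algebra_simps)
    also have "\<dots> \<le> D * (1 - z)" using False by (intro mult_right_mono) (auto simp: D_def q_def)
    finally have "(1 - z) * (1 - z powr s) \<le> (1 - z) * (D * (1 - z))"
      using False by (intro mult_left_mono) auto
    thus ?thesis by (simp add: power2_eq_square algebra_simps)
  qed
  have "z powr r \<le> 1 + r * (z - 1) + (r * D) * (z - 1)\<^sup>2" if z: "0 \<le> z" "z \<le> 4" for z
  proof (cases "z = 0")
    case True
    have "1 \<le> D" by (auto simp: D_def)
    hence "r * 1 \<le> r * D" using assms by (intro mult_left_mono) auto
    moreover have "1 + r * (z - 1) + r * D * (z - 1)\<^sup>2 = 1 - r * 1 + r * D"
      using True by simp
    ultimately show ?thesis using True by simp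
  next
    case False
    hence "0 < z" using z by auto
    have "r * 1 * z powr (r - 1) \<le> 1 powr r + (r - 1) * z powr r"
      using assms z by (intro powr_tangent) auto
    moreover have e: "z powr r = z * z powr s"
      using \<open>0 < z\<close> by (simp add: s_def powr_diff)
    ultimately have "r * z powr s \<le> 1 + (r - 1) * (z * z powr s)"
      by (simp add: s_def)
    hence "z powr r \<le> 1 + r * (z - 1) + r * ((z - 1) * (z powr s - 1))"
      unfolding e by (simp add: algebra_simps)
    also have "\<dots> \<le> 1 + r * (z - 1) + r * (D * (z - 1)\<^sup>2)"
      using main[OF \<open>0 < z\<close> z(2)] assms by (intro add_left_mono mult_left_mono) auto
    finally show ?thesis by simp
  qed
  moreover have "0 \<le> r * D" using assms by (auto simp: D_def)
  ultimately show ?thesis by blast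
qed

text \<open>
  One step of a dyadic martingale: with \<open>X = |x|\<^sup>2\<close>, \<open>D = |d|\<^sup>2\<close>, \<open>P = |x + d|\<^sup>2\<close> and \<open>M = |x - d|\<^sup>2\<close> in a
  Hilbert space this says that the average of \<open>|x + d|\<^sup>p\<close> and \<open>|x - d|\<^sup>p\<close> exceeds \<open>|x|\<^sup>p\<close> by a second
  order term only, where \<open>p = 2 * r\<close>.  The hypotheses are the parallelogram law and the triangle
  inequality.
\<close>

lemma two_point_inequality:
  fixes r :: real
  assumes r: "1 \<le> r"
  shows "\<exists>C\<ge>0. \<forall>X D P M. 0 \<le> X \<longrightarrow> 0 \<le> D \<longrightarrow> 0 \<le> P \<longrightarrow> 0 \<le> M \<longrightarrow>
      P + M = 2 * (X + D) \<longrightarrow> P \<le> (sqrt X + sqrt D)\<^sup>2 \<longrightarrow> M \<le> (sqrt X + sqrt D)\<^sup>2 \<longrightarrow>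
      P powr r + M powr r \<le> 2 * X powr r + C * ((X + D) powr (r - 1) * D)"
proof -
  obtain K where K: "K \<ge> 0" "\<And>z. 0 \<le> z \<Longrightarrow> z \<le> 4 \<Longrightarrow> z powr r \<le> 1 + r * (z - 1) + K * (z - 1)\<^sup>2"
    using powr_second_order[OF r] by auto
  \<comment> \<open>The two entries serve the cases \<open>X \<le> D\<close> and \<open>D < X\<close>.\<close>
  define C where "C = max (2 * 4 powr r) (2 * r + 18 * K)"
  have C: "C \<ge> 0" by (simp add: C_def le_max_iff_disj)
  have "P powr r + M powr r \<le> 2 * X powr r + C * ((X + D) powr (r - 1) * D)"
    if h: "0 \<le> X" "0 \<le> D" "0 \<le> P" "0 \<le> M" "P + M = 2 * (X + D)"
      "P \<le> (sqrt X + sqrt D)\<^sup>2" "M \<le> (sqrt X + sqrt D)\<^sup>2" for X D P M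
  proof (cases "X \<le> D")
    case True
    have "(sqrt X + sqrt D)\<^sup>2 \<le> (sqrt D + sqrt D)\<^sup>2"
      using True h by (intro power_mono add_right_mono) auto
    also have "\<dots> = 4 * D" using h by (simp add: power2_eq_square algebra_simps)
    finally have *: "P \<le> 4 * D" "M \<le> 4 * D" using h by auto
    have "P powr r + M powr r \<le> (4 * D) powr r + (4 * D) powr r"
      using h * r by (intro add_mono powr_mono2) auto
    also have "\<dots> = 2 * 4 powr r * (D powr (r - 1) * D)"
      using h by (cases "D = 0") (auto simp: powr_mult powr_diff)
    also have "\<dots> \<le> C * ((X + D) powr (r - 1) * D)"
      using h r C by (intro mult_mono powr_mono2) (auto simp: C_def)
    finally show ?thesis by (smt (verit) powr_ge_zero)
  next
    case False
    define t where "t = sqrt (D / X)"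
    have X: "X > 0" using False h by auto
    have t: "0 \<le> t" "t \<le> 1" "t\<^sup>2 = D / X" using False h X by (auto simp: t_def)
    have D: "D = t\<^sup>2 * X" using t X by simp
    have sD: "sqrt D = t * sqrt X" using t X by (simp add: t_def real_sqrt_divide)
    have sq: "(sqrt X + sqrt D)\<^sup>2 = (1 + t)\<^sup>2 * X"
      unfolding sD using X by (simp add: power2_eq_square algebra_simps)
    define p m where "p = P / X" and "m = M / X"
    have pm: "P = p * X" "M = m * X" using X by (auto simp: p_def m_def)
    have pb: "0 \<le> p" "0 \<le> m" "p \<le> (1 + t)\<^sup>2" "m \<le> (1 + t)\<^sup>2"
      using h X unfolding sq by (auto simp: p_def m_def field_simps)
    have "(p + m) * X = (2 * (1 + t\<^sup>2)) * X" using h(5) unfolding pm D by (simp add: algebra_simps)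
    hence s: "p + m = 2 * (1 + t\<^sup>2)" using X by simp
    have t2: "t\<^sup>2 \<le> t" using t(1,2) unfolding power2_eq_square by (simp add: mult_left_le)
    have t4: "(1 + t)\<^sup>2 \<le> 1 + 3 * t" using t2 by (simp add: power2_eq_square algebra_simps)
    have abs3: "\<bar>z - 1\<bar> \<le> 3 * t" if "0 \<le> z" "z \<le> (1 + t)\<^sup>2" "2 * (1 + t\<^sup>2) - z \<le> (1 + t)\<^sup>2" for z
    proof -
      have "(1 + t)\<^sup>2 = 1 + 2 * t + t\<^sup>2" by (simp add: power2_eq_square algebra_simps)
      hence "2 * (1 + t\<^sup>2) - z \<le> 1 + 2 * t + t\<^sup>2" using that(3) by simp
      hence "1 - 2 * t \<le> z - t\<^sup>2" by (simp add: algebra_simps)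
      hence "1 - 2 * t \<le> z" using zero_le_power2[of t] by linarith
      moreover have "z \<le> 1 + 3 * t" using that t4 by linarith
      ultimately show ?thesis using t(1) by linarith
    qed
    have sq9: "(z - 1)\<^sup>2 \<le> 9 * t\<^sup>2" if "\<bar>z - 1\<bar> \<le> 3 * t" for z
      using power_mono[OF that, of 2] by (simp add: power_mult_distrib)
    have "p powr r + m powr r \<le> (1 + r * (p - 1) + K * (p - 1)\<^sup>2) + (1 + r * (m - 1) + K * (m - 1)\<^sup>2)"
      using pb t4 t by (intro add_mono K(2)) auto
    also have "\<dots> = 2 + r * (p + m - 2) + K * ((p - 1)\<^sup>2 + (m - 1)\<^sup>2)" by (simp add: algebra_simps)
    also have "\<dots> \<le> 2 + r * (p + m - 2) + K * (9 * t\<^sup>2 + 9 * t\<^sup>2)"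
      using pb s K(1) by (intro add_left_mono mult_left_mono add_mono sq9 abs3) auto
    also have "\<dots> = 2 + (2 * r + 18 * K) * t\<^sup>2" unfolding s by (simp add: algebra_simps)
    finally have "(p powr r + m powr r) * X powr r \<le> (2 + (2 * r + 18 * K) * t\<^sup>2) * X powr r"
      by (intro mult_right_mono) auto
    hence "P powr r + M powr r \<le> 2 * X powr r + (2 * r + 18 * K) * (X powr (r - 1) * D)"
      unfolding pm D using X pb by (simp add: powr_mult algebra_simps powr_diff)
    also have "\<dots> \<le> 2 * X powr r + C * ((X + D) powr (r - 1) * D)"
      using h r C by (intro add_left_mono mult_mono powr_mono2) (auto simp: C_def)
    finally show ?thesis .
  qed
  thus ?thesis using C by blast
qed

section \<open>Bit flips and Doob's maximal inequality\<close>

lemma flip_bit_less: "i < N \<Longrightarrow> u < 2 ^ N \<Longrightarrow> flip_bit i u < (2::nat) ^ N"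
  by (metis take_bit_flip_bit_eq take_bit_nat_eq_self take_bit_nat_less_exp not_le)

lemma flip_bit_flip_bit [simp]: "flip_bit i (flip_bit i u) = (u::nat)"
  by (rule bit_eqI) (auto simp: bit_flip_bit_iff)

lemma flip_bit_commute: "flip_bit i (flip_bit j u) = flip_bit j (flip_bit i (u::nat))"
  by (rule bit_eqI) (auto simp: bit_flip_bit_iff)

lemma sum_flip:
  fixes f :: "nat \<Rightarrow> 'a::comm_monoid_add"
  assumes "i < N"
  shows "(\<Sum>u<2^N. f (flip_bit i u)) = (\<Sum>u<2^N. f u)"
  by (rule sum.reindex_bij_witness[of _ "flip_bit i" "flip_bit i"])
     (use assms in \<open>auto simp: flip_bit_less\<close>)

lemma sum_flip_average:
  fixes f :: "nat \<Rightarrow> real"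
  assumes "i < N"
  shows "(\<Sum>u<2^N. (f u + f (flip_bit i u)) / 2) = (\<Sum>u<2^N. f u)"
  using sum_flip[OF assms, of f] by (simp add: sum.distrib flip: sum_divide_distrib)

primrec runmax :: "(nat \<Rightarrow> real) \<Rightarrow> nat \<Rightarrow> real" where
  "runmax s 0 = s 0"
| "runmax s (Suc n) = max (runmax s n) (s (Suc n))"

lemma le_runmax: "k \<le> n \<Longrightarrow> s k \<le> runmax s n"
  by (induction n) (auto simp: le_Suc_eq)

lemma runmax_nonneg: "(\<And>k. 0 \<le> s k) \<Longrightarrow> 0 \<le> runmax s n"
  by (metis le_runmax order_trans order_refl)

lemma runmax_cong: "(\<And>k. k \<le> n \<Longrightarrow> s k = t k) \<Longrightarrow> runmax s n = runmax t n"
  by (induction n) auto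

text \<open>
  The \<open>k\<close>-th dyadic sigma-algebra is described by its symmetries: a function is measurable with
  respect to it iff flipping a bit of index \<open>i \<ge> k\<close> does not change it, and the conditional expectation
  from level \<open>Suc k\<close> to level \<open>k\<close> is the average over a flip of bit \<open>k\<close>.
\<close>

definition dyadic_submartingale :: "nat \<Rightarrow> (nat \<Rightarrow> nat \<Rightarrow> real) \<Rightarrow> bool" where
  "dyadic_submartingale N s \<longleftrightarrow>
    (\<forall>k u. 0 \<le> s k u) \<and>
    (\<forall>k i u. k \<le> i \<longrightarrow> i < N \<longrightarrow> s k (flip_bit i u) = s k u) \<and>
    (\<forall>k u. k < N \<longrightarrow> 2 * s k u \<le> s (Suc k) u + s (Suc k) (flip_bit k u))"

text \<open>
  With \<open>m n\<close> the maximum of \<open>s 0, \<dots>, s n\<close>, the sum \<open>\<Phi> n\<close> of \<open>q * s n * m n powr (q - 1) - (q - 1) * m n powr q\<close>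
  increases with \<open>n\<close>: replacing \<open>s n\<close> by \<open>s (Suc n)\<close> is the submartingale property, since \<open>m n\<close> is
  invariant under the flip, and replacing \<open>m n\<close> by \<open>m (Suc n)\<close> matters only where \<open>m (Suc n) = s (Suc n)\<close>
  and is then the tangent inequality.  From \<open>\<Phi> N \<ge> 0\<close> the bound follows by absorption.
\<close>

lemma doob_maximal_inequality:
  fixes q :: real
  assumes q: "1 < q"
  shows "\<exists>C\<ge>0. \<forall>N s. dyadic_submartingale N s \<longrightarrow>
    (\<Sum>u<2^N. runmax (\<lambda>k. s k u) N powr q) \<le> C * (\<Sum>u<2^N. s N u powr q)"
proof -
  obtain K where K: "K \<ge> 0" "\<And>x y. 0 \<le> x \<Longrightarrow> 0 \<le> y \<Longrightarrow>
      x powr (q - 1) * y powr 1 \<le> ((q - 1) / (2 * q)) * x powr (q - 1 + 1) + K * y powr (q - 1 + 1)"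
    using powr_mult_absorb[of "q - 1" 1 "(q - 1) / (2 * q)"] q by auto
  define C where "C = 2 * q * K / (q - 1)"
  have "(\<Sum>u<2^N. runmax (\<lambda>k. s k u) N powr q) \<le> C * (\<Sum>u<2^N. s N u powr q)"
    if nn: "\<And>k u. 0 \<le> s k u"
      and inv: "\<And>k i u. k \<le> i \<Longrightarrow> i < N \<Longrightarrow> s k (flip_bit i u) = s k u"
      and sub: "\<And>k u. k < N \<Longrightarrow> 2 * s k u \<le> s (Suc k) u + s (Suc k) (flip_bit k u)"
    for N and s :: "nat \<Rightarrow> nat \<Rightarrow> real"
  proof -
    define m where "m n u = runmax (\<lambda>k. s k u) n" for n u
    have m_nn: "0 \<le> m n u" for n u unfolding m_def using nn by (rule runmax_nonneg)
    have m_inv: "m n (flip_bit n u) = m n u" if "n < N" for n u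
      unfolding m_def using inv that by (intro runmax_cong) auto
    define \<Phi> where "\<Phi> n = (\<Sum>u<2^N. q * s n u * m n u powr (q - 1) - (q - 1) * m n u powr q)" for n
    have "n \<le> N \<Longrightarrow> 0 \<le> \<Phi> n" for n
    proof (induction n)
      case 0
      have "q * s 0 u * m 0 u powr (q - 1) - (q - 1) * m 0 u powr q = s 0 u powr q" for u
        using nn[of 0 u] by (cases "s 0 u = 0") (auto simp: m_def powr_diff algebra_simps)
      thus ?case unfolding \<Phi>_def by (simp add: sum_nonneg)
    next
      case (Suc n)
      hence n: "n < N" by auto
      have half: "s n u \<le> (s (Suc n) u + s (Suc n) (flip_bit n u)) / 2" for u
        using sub[OF n, of u] by (simp add: pos_le_divide_eq mult.commute)
      have "\<Phi> n \<le> (\<Sum>u<2^N. q * ((s (Suc n) u + s (Suc n) (flip_bit n u)) / 2) * m n u powr (q - 1)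
          - (q - 1) * m n u powr q)"
        unfolding \<Phi>_def using q half
        by (intro sum_mono diff_right_mono mult_right_mono mult_left_mono half) auto
      also have "\<dots> = (\<Sum>u<2^N.
          ((q * s (Suc n) u * m n u powr (q - 1) - (q - 1) * m n u powr q)
          + (q * s (Suc n) (flip_bit n u) * m n (flip_bit n u) powr (q - 1)
             - (q - 1) * m n (flip_bit n u) powr q)) / 2)"
        using m_inv[OF n] by (intro sum.cong) (auto simp: field_simps)
      also have "\<dots> = (\<Sum>u<2^N. q * s (Suc n) u * m n u powr (q - 1) - (q - 1) * m n u powr q)"
        using n by (rule sum_flip_average)
      also have "\<dots> \<le> \<Phi> (Suc n)"
        unfolding \<Phi>_def
      proof (intro sum_mono)
        fix u
        show "q * s (Suc n) u * m n u powr (q - 1) - (q - 1) * m n u powr q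
          \<le> q * s (Suc n) u * m (Suc n) u powr (q - 1) - (q - 1) * m (Suc n) u powr q"
        proof (cases "s (Suc n) u \<le> m n u")
          case True
          hence "m (Suc n) u = m n u" by (simp add: m_def)
          thus ?thesis by simp
        next
          case False
          hence e: "m (Suc n) u = s (Suc n) u" by (simp add: m_def)
          have "0 < s (Suc n) u" using False m_nn[of n u] by auto
          hence "q * s (Suc n) u * m (Suc n) u powr (q - 1) - (q - 1) * m (Suc n) u powr q
              = s (Suc n) u powr q"
            unfolding e by (simp add: powr_diff algebra_simps)
          moreover have "q * s (Suc n) u * m n u powr (q - 1)
              \<le> s (Suc n) u powr q + (q - 1) * m n u powr q"
            using q nn m_nn by (intro powr_tangent) auto
          ultimately show ?thesis by linarith
        qed
      qed
      finally show ?case using Suc by simp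
    qed
    hence "0 \<le> \<Phi> N" by simp
    also have "\<Phi> N \<le> (\<Sum>u<2^N. q * K * s N u powr q - (q - 1) / 2 * m N u powr q)"
      unfolding \<Phi>_def
    proof (intro sum_mono)
      fix u
      have "m N u powr (q - 1) * s N u powr 1
        \<le> ((q - 1) / (2 * q)) * m N u powr (q - 1 + 1) + K * s N u powr (q - 1 + 1)"
        using nn m_nn by (intro K(2)) auto
      hence "q * (s N u * m N u powr (q - 1))
        \<le> q * (((q - 1) / (2 * q)) * m N u powr q + K * s N u powr q)"
        using q nn by (intro mult_left_mono) (auto simp: mult.commute)
      also have "\<dots> = (q - 1) / 2 * m N u powr q + q * K * s N u powr q"
        using q by (simp add: field_simps)
      finally show "q * s N u * m N u powr (q - 1) - (q - 1) * m N u powr q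
          \<le> q * K * s N u powr q - (q - 1) / 2 * m N u powr q"
        by (simp add: field_simps)
    qed
    also have "\<dots> = q * K * (\<Sum>u<2^N. s N u powr q) - (q - 1) / 2 * (\<Sum>u<2^N. m N u powr q)"
      by (simp add: sum_subtractf sum_distrib_left)
    finally show ?thesis
      using q unfolding C_def m_def by (simp add: field_simps)
  qed
  moreover have "C \<ge> 0" using q K by (simp add: C_def)
  ultimately show ?thesis unfolding dyadic_submartingale_def by blast
qed

section \<open>Burkholder's inequality for vector-valued dyadic martingales\<close>

lemma L2_set_sq: "(L2_set f J)\<^sup>2 = (\<Sum>j\<in>J. (f j)\<^sup>2)"
  by (simp add: L2_set_def sum_nonneg)

lemma L2_cmod_triangle:
  "L2_set (\<lambda>j. cmod (x j + y j)) J \<le> L2_set (\<lambda>j. cmod (x j)) J + L2_set (\<lambda>j. cmod (y j)) J"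
proof -
  have "L2_set (\<lambda>j. cmod (x j + y j)) J \<le> L2_set (\<lambda>j. cmod (x j) + cmod (y j)) J"
    by (intro L2_set_mono norm_triangle_ineq) auto
  also have "\<dots> \<le> L2_set (\<lambda>j. cmod (x j)) J + L2_set (\<lambda>j. cmod (y j)) J"
    by (rule L2_set_triangle_ineq)
  finally show ?thesis .
qed

lemma cmod_parallelogram:
  "(cmod (x + y))\<^sup>2 + (cmod (x - y))\<^sup>2 = 2 * ((cmod x)\<^sup>2 + (cmod y)\<^sup>2)"
  by (simp add: cmod_power2) (simp add: power2_eq_square algebra_simps)

text \<open>
  Measurability at level \<open>k\<close> and vanishing conditional expectation at the level before.  For the dyadic
  filtration the latter is antisymmetry under the flip of the newest bit.
\<close>

definition dyadic_differences :: "nat \<Rightarrow> (nat \<Rightarrow> nat \<Rightarrow> complex) \<Rightarrow> bool" where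
  "dyadic_differences N d \<longleftrightarrow>
    (\<forall>k i u. k \<le> i \<longrightarrow> i < N \<longrightarrow> d k (flip_bit i u) = d k u) \<and>
    (\<forall>k u. k < N \<longrightarrow> d (Suc k) (flip_bit k u) = - d (Suc k) u)"

text \<open>
  For \<open>p \<ge> 2\<close> a martingale with values in \<open>l\<^sup>2(J)\<close> is controlled by its square function \<open>S\<close>.  Summing the
  two-point inequality over all steps bounds the \<open>p\<close>-th moment by a multiple of the sum of
  \<open>m\<^sup>p\<^sup>-\<^sup>2 S\<^sup>2\<close>, where \<open>m\<close> is the maximal function of the martingale; Young's and Doob's inequalities turn
  this into an estimate by \<open>S\<^sup>p\<close> plus a small multiple of the left-hand side.
\<close>

lemma burkholder_inequality:
  fixes p :: real
  assumes p: "2 \<le> p"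
  shows "\<exists>C\<ge>0. \<forall>N (J :: 'j set) (d :: 'j \<Rightarrow> nat \<Rightarrow> nat \<Rightarrow> complex).
    (\<forall>j. dyadic_differences N (d j)) \<longrightarrow>
    (\<Sum>u<2^N. (\<Sum>j\<in>J. (cmod (\<Sum>k\<le>N. d j k u))\<^sup>2) powr (p / 2))
      \<le> C * (\<Sum>u<2^N. (\<Sum>j\<in>J. \<Sum>k\<le>N. (cmod (d j k u))\<^sup>2) powr (p / 2))"
proof -
  obtain D where D: "D \<ge> 0" and doobD: "\<And>N s. dyadic_submartingale N s \<Longrightarrow>
    (\<Sum>u<2^N. runmax (\<lambda>k. s k u) N powr p) \<le> D * (\<Sum>u<2^N. s N u powr p)"
    using doob_maximal_inequality[of p] p by auto
  obtain A where A: "A \<ge> 0" "\<And>X D P M. 0 \<le> X \<Longrightarrow> 0 \<le> D \<Longrightarrow> 0 \<le> P \<Longrightarrow> 0 \<le> M \<Longrightarrow>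
      P + M = 2 * (X + D) \<Longrightarrow> P \<le> (sqrt X + sqrt D)\<^sup>2 \<Longrightarrow> M \<le> (sqrt X + sqrt D)\<^sup>2 \<Longrightarrow>
      P powr (p / 2) + M powr (p / 2) \<le> 2 * X powr (p / 2) + A * ((X + D) powr (p / 2 - 1) * D)"
    using two_point_inequality[of "p / 2"] p by fastforce
  define B where "B = 1 + A * 5 powr (p / 2 - 1)"
  have B: "B \<ge> 1" using A by (simp add: B_def)
  define e where "e = 1 / (2 * (D * B + 1))"
  have DB: "0 \<le> D * B" using D B by auto
  hence e0: "e > 0" by (simp add: e_def)
  have "D * B * e \<le> (D * B + 1) * e" using e0 by (intro mult_right_mono) auto
  also have "\<dots> = 1 / 2" unfolding e_def using DB by (simp add: field_simps)
  finally have e: "e > 0" "D * B * e \<le> 1 / 2" using e0 by auto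
  obtain K where K: "K \<ge> 0" "\<And>x y. 0 \<le> x \<Longrightarrow> 0 \<le> y \<Longrightarrow>
      x powr (p - 2) * y powr 2 \<le> e * x powr (p - 2 + 2) + K * y powr (p - 2 + 2)"
    using powr_mult_absorb[of "p - 2" 2 e] p e by auto
  define C where "C = 2 * (D * B * K)"
  have main: "(\<Sum>u<2^N. (\<Sum>j\<in>J. (cmod (\<Sum>k\<le>N. d j k u))\<^sup>2) powr (p / 2))
      \<le> C * (\<Sum>u<2^N. (\<Sum>j\<in>J. \<Sum>k\<le>N. (cmod (d j k u))\<^sup>2) powr (p / 2))"
    if inv: "\<And>j k i u. k \<le> i \<Longrightarrow> i < N \<Longrightarrow> d j k (flip_bit i u) = d j k u"
      and anti: "\<And>j k u. k < N \<Longrightarrow> d j (Suc k) (flip_bit k u) = - d j (Suc k) u"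
    for N and J :: "'j set" and d :: "'j \<Rightarrow> nat \<Rightarrow> nat \<Rightarrow> complex"
  proof -
    define h where "h n j u = (\<Sum>k\<le>n. d j k u)" for n j u
    define s where "s n u = L2_set (\<lambda>j. cmod (h n j u)) J" for n u
    define w where "w n u = L2_set (\<lambda>j. cmod (d j n u)) J" for n u
    define m where "m u = runmax (\<lambda>k. s k u) N" for u
    define S where "S u = (\<Sum>j\<in>J. \<Sum>k\<le>N. (cmod (d j k u))\<^sup>2)" for u
    have nn: "0 \<le> s n u" "0 \<le> w n u" for n u by (simp_all add: s_def w_def)
    have S_nn: "0 \<le> S u" for u by (simp add: S_def sum_nonneg)
    have h_Suc: "h (Suc n) j u = h n j u + d j (Suc n) u" for n j u by (simp add: h_def)
    have h_inv: "h k j (flip_bit i u) = h k j u" if "k \<le> i" "i < N" for k i j u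
      unfolding h_def using that inv by (intro sum.cong) auto
    have h_flip: "h (Suc k) j (flip_bit k u) = h k j u - d j (Suc k) u" if "k < N" for k j u
      using that by (simp add: h_Suc h_inv anti)
    have s_inv: "s k (flip_bit i u) = s k u" if "k \<le> i" "i < N" for k i u
      using that by (simp add: s_def h_inv)
    have w_flip: "w (Suc k) (flip_bit k u) = w (Suc k) u" if "k < N" for k u
      using that by (simp add: w_def anti)
    have par: "(s (Suc k) u)\<^sup>2 + (s (Suc k) (flip_bit k u))\<^sup>2 = 2 * ((s k u)\<^sup>2 + (w (Suc k) u)\<^sup>2)"
      if "k < N" for k u
      using that unfolding s_def w_def L2_set_sq
      by (simp add: h_inv anti sum.distrib[symmetric] sum_distrib_left cmod_parallelogram h_Suc)
    have tri1: "s (Suc k) u \<le> s k u + w (Suc k) u" for k u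
      unfolding s_def w_def h_Suc by (rule L2_cmod_triangle)
    have tri2: "w (Suc k) u \<le> s (Suc k) u + s k u" for k u
      using L2_cmod_triangle[of "\<lambda>j. h (Suc k) j u" "\<lambda>j. - h k j u" J]
      unfolding s_def w_def h_Suc by simp
    have sub: "2 * s k u \<le> s (Suc k) u + s (Suc k) (flip_bit k u)" if k: "k < N" for k u
    proof -
      have e: "h (Suc k) j u + h (Suc k) j (flip_bit k u) = 2 * h k j u" for j
        using k by (simp add: h_Suc h_inv anti)
      have "2 * s k u = L2_set (\<lambda>j. cmod (h (Suc k) j u + h (Suc k) j (flip_bit k u))) J"
        unfolding e s_def by (simp add: norm_mult L2_set_right_distrib)
      also have "\<dots> \<le> s (Suc k) u + s (Suc k) (flip_bit k u)"
        unfolding s_def by (rule L2_cmod_triangle)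
      finally show ?thesis .
    qed
    have le_m: "s k u \<le> m u" if "k \<le> N" for k u
      unfolding m_def by (rule le_runmax[OF that])
    have m_nn: "0 \<le> m u" for u unfolding m_def by (rule runmax_nonneg) (rule nn)
    have pw: "(x\<^sup>2) powr (p / 2) = x powr p" if "0 \<le> x" for x :: real
      using that by (simp add: powr_powr flip: powr_numeral)
    have sqrt_powr: "sqrt x powr a = x powr (a / 2)" if "0 \<le> x" for x a :: real
      unfolding powr_half_sqrt[OF that, symmetric] powr_powr by simp
    have half: "x / 2 \<le> y + z" if "x \<le> 2 * y + z" "0 \<le> z" for x y z :: real
      using that by simp
    have step: "(\<Sum>u<2^N. s (Suc k) u powr p)
        \<le> (\<Sum>u<2^N. s k u powr p + B * (m u powr (p - 2) * (w (Suc k) u)\<^sup>2))" if k: "k < N" for k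
    proof -
      have "(\<Sum>u<2^N. s (Suc k) u powr p)
          = (\<Sum>u<2^N. (s (Suc k) u powr p + s (Suc k) (flip_bit k u) powr p) / 2)"
        using k by (rule sum_flip_average[symmetric])
      also have "\<dots> \<le> (\<Sum>u<2^N. s k u powr p + B * (m u powr (p - 2) * (w (Suc k) u)\<^sup>2))"
      proof (intro sum_mono)
        fix u
        have "s (Suc k) (flip_bit k u) \<le> s k u + w (Suc k) u"
          using tri1[of k "flip_bit k u"] k by (simp add: s_inv w_flip)
        hence "((s (Suc k) u)\<^sup>2) powr (p / 2) + ((s (Suc k) (flip_bit k u))\<^sup>2) powr (p / 2)
          \<le> 2 * ((s k u)\<^sup>2) powr (p / 2)
            + A * (((s k u)\<^sup>2 + (w (Suc k) u)\<^sup>2) powr (p / 2 - 1) * (w (Suc k) u)\<^sup>2)"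
          using tri1[of k u] par[OF k, of u] nn by (intro A(2)) (auto intro!: power_mono)
        hence 1: "s (Suc k) u powr p + s (Suc k) (flip_bit k u) powr p
          \<le> 2 * s k u powr p
            + A * (((s k u)\<^sup>2 + (w (Suc k) u)\<^sup>2) powr (p / 2 - 1) * (w (Suc k) u)\<^sup>2)"
          using nn by (simp add: pw)
        have "w (Suc k) u \<le> 2 * m u"
          using tri2[of k u] le_m[of k u] le_m[of "Suc k" u] k by simp
        hence "(s k u)\<^sup>2 + (w (Suc k) u)\<^sup>2 \<le> (m u)\<^sup>2 + (2 * m u)\<^sup>2"
          using nn le_m[of k u] k by (intro add_mono power_mono) auto
        hence "((s k u)\<^sup>2 + (w (Suc k) u)\<^sup>2) powr (p / 2 - 1) \<le> (5 * (m u)\<^sup>2) powr (p / 2 - 1)"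
          using p by (intro powr_mono2) auto
        also have "\<dots> = 5 powr (p / 2 - 1) * ((m u)\<^sup>2) powr (p / 2 - 1)"
          by (simp add: powr_mult)
        also have "((m u)\<^sup>2) powr (p / 2 - 1) = m u powr (p - 2)"
          using m_nn[of u] by (simp add: powr_powr algebra_simps flip: powr_numeral)
        finally have "A * (((s k u)\<^sup>2 + (w (Suc k) u)\<^sup>2) powr (p / 2 - 1) * (w (Suc k) u)\<^sup>2)
          \<le> A * ((5 powr (p / 2 - 1) * m u powr (p - 2)) * (w (Suc k) u)\<^sup>2)"
          using A by (intro mult_left_mono mult_right_mono) auto
        also have "\<dots> \<le> B * (m u powr (p - 2) * (w (Suc k) u)\<^sup>2)"
          unfolding B_def by (simp add: algebra_simps)
        finally have "(s (Suc k) u powr p + s (Suc k) (flip_bit k u) powr p)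
          \<le> 2 * s k u powr p + B * (m u powr (p - 2) * (w (Suc k) u)\<^sup>2)"
          using 1 by linarith
        moreover have "0 \<le> B * (m u powr (p - 2) * (w (Suc k) u)\<^sup>2)" using B by auto
        ultimately show "(s (Suc k) u powr p + s (Suc k) (flip_bit k u) powr p) / 2
          \<le> s k u powr p + B * (m u powr (p - 2) * (w (Suc k) u)\<^sup>2)" by (rule half)
      qed
      finally show ?thesis .
    qed
    have tot: "n \<le> N \<Longrightarrow> (\<Sum>u<2^N. s n u powr p)
        \<le> (\<Sum>u<2^N. B * (m u powr (p - 2) * (\<Sum>k\<le>n. (w k u)\<^sup>2)))" for n
    proof (induction n)
      case 0
      show ?case
      proof (intro sum_mono)
        fix u
        have "s 0 u = w 0 u" by (simp add: s_def w_def h_def)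
        moreover have "s 0 u powr p \<le> m u powr (p - 2) * (s 0 u)\<^sup>2"
        proof (cases "s 0 u = 0")
          case False
          hence "s 0 u > 0" using nn[of 0 u] by auto
          hence "s 0 u powr p = s 0 u powr (p - 2) * (s 0 u)\<^sup>2"
            by (simp add: powr_diff)
          also have "\<dots> \<le> m u powr (p - 2) * (s 0 u)\<^sup>2"
            using p nn le_m[of 0 u] by (intro mult_right_mono powr_mono2) auto
          finally show ?thesis .
        qed auto
        moreover have "1 * (m u powr (p - 2) * (s 0 u)\<^sup>2) \<le> B * (m u powr (p - 2) * (s 0 u)\<^sup>2)"
          using B by (intro mult_right_mono) auto
        ultimately show "s 0 u powr p \<le> B * (m u powr (p - 2) * (\<Sum>k\<le>0. (w k u)\<^sup>2))"
          by simp
      qed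
    next
      case (Suc n)
      have "(\<Sum>u<2^N. s (Suc n) u powr p)
        \<le> (\<Sum>u<2^N. s n u powr p) + (\<Sum>u<2^N. B * (m u powr (p - 2) * (w (Suc n) u)\<^sup>2))"
        using step[of n] Suc by (simp add: sum.distrib)
      also have "\<dots> \<le> (\<Sum>u<2^N. B * (m u powr (p - 2) * (\<Sum>k\<le>n. (w k u)\<^sup>2)))
          + (\<Sum>u<2^N. B * (m u powr (p - 2) * (w (Suc n) u)\<^sup>2))"
        using Suc by (intro add_right_mono) auto
      also have "\<dots> = (\<Sum>u<2^N. B * (m u powr (p - 2) * (\<Sum>k\<le>Suc n. (w k u)\<^sup>2)))"
        by (simp add: sum.distrib[symmetric] algebra_simps)
      finally show ?case .
    qed
    have S_w: "S u = (\<Sum>k\<le>N. (w k u)\<^sup>2)" for u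
      unfolding S_def w_def L2_set_sq by (rule sum.swap)
    define E where "E = (\<Sum>u<2^N. m u powr p)"
    define T where "T = (\<Sum>u<2^N. S u powr (p / 2))"
    have "E \<le> D * (\<Sum>u<2^N. s N u powr p)"
      unfolding m_def E_def using nn s_inv sub by (intro doobD) (auto simp: dyadic_submartingale_def)
    also have "\<dots> \<le> D * (\<Sum>u<2^N. B * (e * m u powr p + K * S u powr (p / 2)))"
    proof (rule mult_left_mono[OF order_trans[OF tot[OF order_refl] sum_mono] D])
      fix u
      have "m u powr (p - 2) * sqrt (S u) powr 2
        \<le> e * m u powr (p - 2 + 2) + K * sqrt (S u) powr (p - 2 + 2)"
        using m_nn S_nn by (intro K(2)) auto
      hence "m u powr (p - 2) * S u \<le> e * m u powr p + K * S u powr (p / 2)"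
        using S_nn[of u] by (simp add: sqrt_powr)
      thus "B * (m u powr (p - 2) * (\<Sum>k\<le>N. (w k u)\<^sup>2)) \<le> B * (e * m u powr p + K * S u powr (p / 2))"
        using B unfolding S_w[symmetric] by (intro mult_left_mono) auto
    qed
    also have "\<dots> = (D * B * e) * E + (D * B * K) * T"
      unfolding E_def T_def by (simp add: sum.distrib sum_distrib_left algebra_simps)
    also have "\<dots> \<le> 1 / 2 * E + (D * B * K) * T"
      using e by (intro add_right_mono mult_right_mono) (auto simp: E_def sum_nonneg)
    finally have "E \<le> C * T" by (simp add: C_def)
    moreover have "(\<Sum>u<2^N. (\<Sum>j\<in>J. (cmod (\<Sum>k\<le>N. d j k u))\<^sup>2) powr (p / 2)) \<le> E"
      unfolding E_def
    proof (intro sum_mono)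
      fix u
      have "(\<Sum>j\<in>J. (cmod (\<Sum>k\<le>N. d j k u))\<^sup>2) powr (p / 2) = s N u powr p"
        using nn by (simp add: pw[symmetric]) (simp add: s_def L2_set_sq h_def)
      also have "\<dots> \<le> m u powr p" using nn le_m[of N u] p by (intro powr_mono2) auto
      finally show "(\<Sum>j\<in>J. (cmod (\<Sum>k\<le>N. d j k u))\<^sup>2) powr (p / 2) \<le> m u powr p" .
    qed
    ultimately show ?thesis by (simp add: T_def S_def)
  qed
  have C: "C \<ge> 0" using D B K by (simp add: C_def)
  show ?thesis
    by (intro exI[of _ C] conjI allI impI main C) (auto simp: dyadic_differences_def)
qed

section \<open>Walsh functions on a finite grid\<close>

lemma bit_less_exp: "n < 2 ^ N \<Longrightarrow> bit (n::nat) i \<Longrightarrow> i < N"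
  by (metis bit_take_bit_iff take_bit_nat_eq_self)

lemma exp_le_bits: "(\<And>i. bit n i \<Longrightarrow> i < N) \<Longrightarrow> (n::nat) < 2 ^ N"
proof -
  assume *: "\<And>i. bit n i \<Longrightarrow> i < N"
  have "take_bit N n = n" by (rule bit_eqI) (auto simp: bit_take_bit_iff dest: *)
  thus ?thesis by (simp add: take_bit_nat_eq_self_iff)
qed

text \<open>
  The discrete Walsh functions: characters of \<open>(\<int>/2)\<^sup>N\<close>, where both frequencies and points are numbers
  below \<open>2 ^ N\<close> read as bit vectors, so that the roles of \<open>n\<close> and \<open>u\<close> are symmetric.
\<close>

definition wal :: "nat \<Rightarrow> nat \<Rightarrow> nat \<Rightarrow> real" where
  "wal N n u = (\<Prod>i<N. if bit n i \<and> bit u i then -1 else 1)"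

lemma wal_commute: "wal N n u = wal N u n"
  by (simp add: wal_def conj_commute)

lemma wal_square [simp]: "wal N n u * wal N n u = 1"
  unfolding wal_def prod.distrib[symmetric] by (rule prod.neutral) auto

lemma abs_wal [simp]: "\<bar>wal N n u\<bar> = 1"
  by (metis abs_mult abs_one abs_mult_self_eq wal_square abs_square_eq_1 power2_eq_square)

lemma wal_flip:
  assumes "i < N"
  shows "wal N n (flip_bit i u) = (if bit n i then - wal N n u else wal N n u)"
proof -
  have "wal N n (flip_bit i u)
      = (\<Prod>j<N. (if j = i then (if bit n i then -1 else 1) else 1)
          * (if bit n j \<and> bit u j then -1 else 1))"
    unfolding wal_def by (intro prod.cong) (auto simp: bit_flip_bit_iff)
  also have "\<dots> = (if bit n i then -1 else 1) * wal N n u"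
    using assms by (simp add: prod.distrib wal_def)
  finally show ?thesis by simp
qed

lemma wal_flip_left:
  "i < N \<Longrightarrow> wal N (flip_bit i n) u = (if bit u i then - wal N n u else wal N n u)"
  using wal_flip[of i N u n] by (simp add: wal_commute)

lemma wal_orthogonal:
  assumes "n < 2 ^ N" "n' < 2 ^ N"
  shows "(\<Sum>u<2^N. wal N n u * wal N n' u) = (if n = n' then 2 ^ N else 0)"
proof (cases "n = n'")
  case False
  then obtain i where i: "bit n i \<noteq> bit n' i" by (auto simp: bit_eq_iff)
  hence "i < N" using assms bit_less_exp by blast
  have "(\<Sum>u<2^N. wal N n u * wal N n' u)
      = (\<Sum>u<2^N. wal N n (flip_bit i u) * wal N n' (flip_bit i u))"
    using \<open>i < N\<close> by (rule sum_flip[symmetric])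
  also have "\<dots> = - (\<Sum>u<2^N. wal N n u * wal N n' u)"
    using i \<open>i < N\<close> by (auto simp: wal_flip sum_negf)
  finally show ?thesis using False by simp
qed simp

definition grid :: "nat \<Rightarrow> (nat \<times> nat) set" where
  "grid N = {..<2^N} \<times> {..<2^N}"

lemma finite_grid [simp]: "finite (grid N)"
  by (simp add: grid_def)

lemma sum_grid: "sum f (grid N) = (\<Sum>u<2^N. \<Sum>v<2^N. f (u, v))"
  unfolding grid_def by (rule sum.cartesian_product')

lemma sum_grid_swap: "sum f (grid N) = (\<Sum>v<2^N. \<Sum>u<2^N. f (u, v))"
  unfolding sum_grid by (rule sum.swap)

definition wal2 :: "nat \<Rightarrow> nat \<times> nat \<Rightarrow> nat \<times> nat \<Rightarrow> real" where
  "wal2 N a x = wal N (fst a) (fst x) * wal N (snd a) (snd x)"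

definition grid_coef :: "nat \<Rightarrow> (nat \<times> nat \<Rightarrow> complex) \<Rightarrow> nat \<times> nat \<Rightarrow> complex" where
  "grid_coef N F a = (\<Sum>x\<in>grid N. F x * of_real (wal2 N a x)) / 4 ^ N"

definition grid_mult :: "nat \<Rightarrow> (nat \<times> nat) set \<Rightarrow> (nat \<times> nat \<Rightarrow> complex) \<Rightarrow> nat \<times> nat \<Rightarrow> complex" where
  "grid_mult N Q F x = (\<Sum>a\<in>Q. grid_coef N F a * of_real (wal2 N a x))"

lemma wal2_orthogonal:
  assumes "a \<in> grid N" "b \<in> grid N"
  shows "(\<Sum>x\<in>grid N. wal2 N a x * wal2 N b x) = (if a = b then 4 ^ N else 0)"
proof -
  have "(\<Sum>x\<in>grid N. wal2 N a x * wal2 N b x)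
      = (\<Sum>u<2^N. wal N (fst a) u * wal N (fst b) u) * (\<Sum>v<2^N. wal N (snd a) v * wal N (snd b) v)"
    unfolding sum_grid wal2_def sum_product by (simp add: mult_ac)
  also have "\<dots> = (if a = b then 2 ^ N * 2 ^ N else 0)"
    using assms by (simp add: wal_orthogonal grid_def prod_eq_iff mem_Times_iff)
  also have "(2::real) ^ N * 2 ^ N = 4 ^ N" by (simp flip: power_mult_distrib)
  finally show ?thesis .
qed

lemma parseval_orthogonal:
  fixes e :: "'i \<Rightarrow> 'x \<Rightarrow> real" and c :: "'i \<Rightarrow> complex"
  assumes "finite I"
    and orth: "\<And>i j. i \<in> I \<Longrightarrow> j \<in> I \<Longrightarrow> (\<Sum>x\<in>P. e i x * e j x) = (if i = j then D else 0)"
  shows "(\<Sum>x\<in>P. (cmod (\<Sum>i\<in>I. c i * e i x))\<^sup>2) = D * (\<Sum>i\<in>I. (cmod (c i))\<^sup>2)"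
proof -
  have "complex_of_real (\<Sum>x\<in>P. (cmod (\<Sum>i\<in>I. c i * e i x))\<^sup>2)
      = (\<Sum>x\<in>P. \<Sum>i\<in>I. \<Sum>j\<in>I. c i * cnj (c j) * complex_of_real (e i x * e j x))"
    unfolding of_real_sum complex_norm_square cnj_sum sum_product
    by (intro sum.cong) (auto simp: algebra_simps)
  also have "\<dots> = (\<Sum>i\<in>I. \<Sum>x\<in>P. \<Sum>j\<in>I. c i * cnj (c j) * complex_of_real (e i x * e j x))"
    by (rule sum.swap)
  also have "\<dots> = (\<Sum>i\<in>I. \<Sum>j\<in>I. \<Sum>x\<in>P. c i * cnj (c j) * complex_of_real (e i x * e j x))"
    by (intro sum.cong refl sum.swap)
  also have "\<dots> = (\<Sum>i\<in>I. \<Sum>j\<in>I. c i * cnj (c j) * complex_of_real (if i = j then D else 0))"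
    by (intro sum.cong) (simp_all add: orth[symmetric] sum_distrib_left)
  also have "\<dots> = (\<Sum>i\<in>I. \<Sum>j\<in>I. if i = j then c i * cnj (c j) * complex_of_real D else 0)"
    by (intro sum.cong) auto
  also have "\<dots> = complex_of_real (D * (\<Sum>i\<in>I. (cmod (c i))\<^sup>2))"
    using assms(1)
    by (simp add: sum_distrib_left of_real_sum mult.commute complex_norm_square[symmetric] del: of_real_power)
  finally show ?thesis by (simp only: of_real_eq_iff)
qed

lemma bessel_orthogonal:
  fixes e :: "'i \<Rightarrow> 'x \<Rightarrow> real" and F :: "'x \<Rightarrow> complex"
  assumes "finite I" "0 < D"
    and orth: "\<And>i j. i \<in> I \<Longrightarrow> j \<in> I \<Longrightarrow> (\<Sum>x\<in>P. e i x * e j x) = (if i = j then D else 0)"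
  shows "(\<Sum>i\<in>I. (cmod (\<Sum>x\<in>P. F x * e i x))\<^sup>2) \<le> D * (\<Sum>x\<in>P. (cmod (F x))\<^sup>2)"
proof -
  define b where "b i = (\<Sum>x\<in>P. F x * e i x)" for i
  define c where "c i = b i / D" for i
  define G where "G x = (\<Sum>i\<in>I. c i * e i x)" for x
  define B where "B = (\<Sum>i\<in>I. (cmod (b i))\<^sup>2)"
  have expand: "(cmod (F x - G x))\<^sup>2 = (cmod (F x))\<^sup>2 + (cmod (G x))\<^sup>2 - 2 * Re (F x * cnj (G x))" for x
    by (simp only: cmod_power2) (simp add: power2_eq_square algebra_simps)
  have "(\<Sum>x\<in>P. F x * cnj (G x)) = (\<Sum>x\<in>P. \<Sum>i\<in>I. cnj (c i) * (F x * e i x))"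
    unfolding G_def cnj_sum sum_distrib_left by (simp add: mult_ac)
  also have "\<dots> = (\<Sum>i\<in>I. cnj (c i) * b i)"
    unfolding b_def sum_distrib_left by (rule sum.swap)
  also have "\<dots> = (\<Sum>i\<in>I. complex_of_real ((cmod (b i))\<^sup>2 / D))"
    unfolding c_def of_real_divide complex_norm_square by (simp add: mult.commute)
  also have "\<dots> = complex_of_real (B / D)"
    by (simp add: B_def sum_divide_distrib)
  finally have "(\<Sum>x\<in>P. Re (F x * cnj (G x))) = B / D"
    by (metis Re_sum Re_complex_of_real)
  moreover have "(\<Sum>x\<in>P. (cmod (G x))\<^sup>2) = D * (\<Sum>i\<in>I. (cmod (c i))\<^sup>2)"
    unfolding G_def using assms by (intro parseval_orthogonal) auto
  moreover have "D * (\<Sum>i\<in>I. (cmod (c i))\<^sup>2) = B / D"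
    using assms by (simp add: c_def B_def norm_divide power_divide sum_distrib_left sum_divide_distrib power2_eq_square)
  moreover have "0 \<le> (\<Sum>x\<in>P. (cmod (F x - G x))\<^sup>2)" by (intro sum_nonneg) auto
  ultimately have "B / D \<le> (\<Sum>x\<in>P. (cmod (F x))\<^sup>2)"
    unfolding expand by (simp add: sum.distrib sum_subtractf flip: sum_distrib_left)
  thus ?thesis using assms by (simp add: B_def b_def field_simps)
qed

lemma bessel_mult:
  assumes "finite T" "\<And>i. i \<in> T \<Longrightarrow> Q i \<subseteq> grid N" "disjoint_family_on Q T"
  shows "(\<Sum>i\<in>T. \<Sum>x\<in>grid N. (cmod (grid_mult N (Q i) F x))\<^sup>2) \<le> (\<Sum>x\<in>grid N. (cmod (F x))\<^sup>2)"
proof -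
  have fin: "finite (Q i)" if "i \<in> T" for i
    using assms(2)[OF that] by (rule finite_subset) simp
  have "(\<Sum>i\<in>T. \<Sum>x\<in>grid N. (cmod (grid_mult N (Q i) F x))\<^sup>2)
      = (\<Sum>i\<in>T. 4 ^ N * (\<Sum>a\<in>Q i. (cmod (grid_coef N F a))\<^sup>2))"
    unfolding grid_mult_def using assms(2) fin
    by (intro sum.cong refl parseval_orthogonal wal2_orthogonal) auto
  also have "\<dots> = 4 ^ N * (\<Sum>a\<in>\<Union>(Q ` T). (cmod (grid_coef N F a))\<^sup>2)"
    using assms fin unfolding disjoint_family_on_def
    by (subst sum.UNION_disjoint) (auto simp: sum_distrib_left)
  also have "\<dots> = (\<Sum>a\<in>\<Union>(Q ` T). (cmod (\<Sum>x\<in>grid N. F x * wal2 N a x))\<^sup>2) / 4 ^ N"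
    by (simp add: grid_coef_def norm_divide norm_power power_divide sum_divide_distrib[symmetric] power2_eq_square)
  also have "\<dots> \<le> (4 ^ N * (\<Sum>x\<in>grid N. (cmod (F x))\<^sup>2)) / 4 ^ N"
    using assms(1,2) fin
    by (intro divide_right_mono bessel_orthogonal wal2_orthogonal) auto
  finally show ?thesis by simp
qed

text \<open>
  Products of dyadic intervals of lengths \<open>2 ^ k\<close> and \<open>2 ^ l\<close> in the frequency grid (or the empty set).
  The low bits of a frequency are free and its high bits are fixed; the first property makes the
  multiplier local, the second makes its modulus locally constant.
\<close>

definition dyadic_rect :: "nat \<Rightarrow> nat \<Rightarrow> nat \<Rightarrow> (nat \<times> nat) set \<Rightarrow> bool" where
  "dyadic_rect N k l Q \<longleftrightarrow> k \<le> N \<and> l \<le> N \<and> Q \<subseteq> grid N \<and>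
    (\<forall>a\<in>Q. (\<forall>i<k. (flip_bit i (fst a), snd a) \<in> Q) \<and> (\<forall>i<l. (fst a, flip_bit i (snd a)) \<in> Q)) \<and>
    (\<forall>a\<in>Q. \<forall>b\<in>Q. (\<forall>i\<ge>k. bit (fst a) i = bit (fst b) i) \<and> (\<forall>i\<ge>l. bit (snd a) i = bit (snd b) i))"

text \<open>
  Flipping a low bit of the frequency, in which the two points differ, changes the sign of exactly one
  of the two Walsh functions and permutes \<open>Q\<close>, so the kernel equals its own negative.
\<close>

lemma dyadic_kernel_eq_0:
  assumes Q: "dyadic_rect N k l Q"
    and x: "(\<exists>i<k. bit (fst x) i \<noteq> bit (fst y) i) \<or> (\<exists>i<l. bit (snd x) i \<noteq> bit (snd y) i)"
  shows "(\<Sum>a\<in>Q. wal2 N a x * wal2 N a y) = 0"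
proof -
  let ?S = "\<Sum>a\<in>Q. wal2 N a x * wal2 N a y"
  from x have "?S = - ?S"
  proof (elim disjE exE conjE)
    fix i assume i: "i < k" "bit (fst x) i \<noteq> bit (fst y) i"
    hence "i < N" using Q by (auto simp: dyadic_rect_def)
    have "?S = (\<Sum>a\<in>Q. - (wal2 N a x * wal2 N a y))"
      by (rule sum.reindex_bij_witness[of _ "\<lambda>a. (flip_bit i (fst a), snd a)" "\<lambda>a. (flip_bit i (fst a), snd a)"])
         (use i \<open>i < N\<close> Q in \<open>auto simp: dyadic_rect_def wal2_def wal_flip_left\<close>)
    thus ?thesis by (simp add: sum_negf)
  next
    fix i assume i: "i < l" "bit (snd x) i \<noteq> bit (snd y) i"
    hence "i < N" using Q by (auto simp: dyadic_rect_def)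
    have "?S = (\<Sum>a\<in>Q. - (wal2 N a x * wal2 N a y))"
      by (rule sum.reindex_bij_witness[of _ "\<lambda>a. (fst a, flip_bit i (snd a))" "\<lambda>a. (fst a, flip_bit i (snd a))"])
         (use i \<open>i < N\<close> Q in \<open>auto simp: dyadic_rect_def wal2_def wal_flip_left\<close>)
    thus ?thesis by (simp add: sum_negf)
  qed
  thus ?thesis by simp
qed

lemma mult_kernel:
  "grid_mult N Q F x = (\<Sum>y\<in>grid N. F y * of_real (\<Sum>a\<in>Q. wal2 N a y * wal2 N a x)) / 4 ^ N"
proof -
  have "grid_mult N Q F x = (\<Sum>a\<in>Q. \<Sum>y\<in>grid N. F y * of_real (wal2 N a y * wal2 N a x) / 4 ^ N)"
    unfolding grid_mult_def grid_coef_def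
    by (simp add: sum_divide_distrib sum_distrib_right mult.assoc)
  also have "\<dots> = (\<Sum>y\<in>grid N. \<Sum>a\<in>Q. F y * of_real (wal2 N a y * wal2 N a x) / 4 ^ N)"
    by (rule sum.swap)
  also have "\<dots> = (\<Sum>y\<in>grid N. F y * of_real (\<Sum>a\<in>Q. wal2 N a y * wal2 N a x)) / 4 ^ N"
    by (simp add: sum_distrib_left sum_divide_distrib)
  finally show ?thesis .
qed

lemma mult_dyadic_local:
  assumes Q: "dyadic_rect N k l Q"
    and eq: "\<And>y. y \<in> grid N \<Longrightarrow> (\<forall>i<k. bit (fst y) i = bit (fst x) i) \<Longrightarrow>
      (\<forall>i<l. bit (snd y) i = bit (snd x) i) \<Longrightarrow> F y = G y"
  shows "grid_mult N Q F x = grid_mult N Q G x"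
proof -
  have "F y * of_real (\<Sum>a\<in>Q. wal2 N a y * wal2 N a x)
      = G y * of_real (\<Sum>a\<in>Q. wal2 N a y * wal2 N a x)" if "y \<in> grid N" for y
  proof (cases "(\<exists>i<k. bit (fst y) i \<noteq> bit (fst x) i) \<or> (\<exists>i<l. bit (snd y) i \<noteq> bit (snd x) i)")
    case True
    thus ?thesis by (simp only: dyadic_kernel_eq_0[OF Q] of_real_0 mult_zero_right)
  next
    case False
    hence "F y = G y" using that by (intro eq) auto
    thus ?thesis by simp
  qed
  thus ?thesis unfolding mult_kernel by (simp only: cong: sum.cong)
qed

lemma cmod_mult_dyadic_flip:
  assumes Q: "dyadic_rect N k l Q"
  shows "k \<le> i \<Longrightarrow> i < N \<Longrightarrow> cmod (grid_mult N Q F (flip_bit i u, v)) = cmod (grid_mult N Q F (u, v))"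
    and "l \<le> i \<Longrightarrow> i < N \<Longrightarrow> cmod (grid_mult N Q F (u, flip_bit i v)) = cmod (grid_mult N Q F (u, v))"
proof -
  show "cmod (grid_mult N Q F (flip_bit i u, v)) = cmod (grid_mult N Q F (u, v))" if i: "k \<le> i" "i < N"
  proof (cases "Q = {}")
    case False
    then obtain b where b: "b \<in> Q" by auto
    define s where "s = (if bit (fst b) i then - 1 else 1 :: complex)"
    have "bit (fst a) i = bit (fst b) i" if "a \<in> Q" for a
      using Q b that i unfolding dyadic_rect_def by blast
    hence "grid_mult N Q F (flip_bit i u, v) = (\<Sum>a\<in>Q. s * (grid_coef N F a * wal2 N a (u, v)))"
      unfolding grid_mult_def using i by (intro sum.cong) (auto simp: s_def wal2_def wal_flip)
    also have "\<dots> = s * grid_mult N Q F (u, v)" by (simp add: grid_mult_def sum_distrib_left)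
    finally show ?thesis by (simp add: norm_mult s_def)
  qed (simp add: grid_mult_def)
  show "cmod (grid_mult N Q F (u, flip_bit i v)) = cmod (grid_mult N Q F (u, v))" if i: "l \<le> i" "i < N"
  proof (cases "Q = {}")
    case False
    then obtain b where b: "b \<in> Q" by auto
    define s where "s = (if bit (snd b) i then - 1 else 1 :: complex)"
    have "bit (snd a) i = bit (snd b) i" if "a \<in> Q" for a
      using Q b that i unfolding dyadic_rect_def by blast
    hence "grid_mult N Q F (u, flip_bit i v) = (\<Sum>a\<in>Q. s * (grid_coef N F a * wal2 N a (u, v)))"
      unfolding grid_mult_def using i by (intro sum.cong) (auto simp: s_def wal2_def wal_flip)
    also have "\<dots> = s * grid_mult N Q F (u, v)" by (simp add: grid_mult_def sum_distrib_left)
    finally show ?thesis by (simp add: norm_mult s_def)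
  qed (simp add: grid_mult_def)
qed

section \<open>Averages and the strong maximal function\<close>

text \<open>
  Translates between the two descriptions of measurability: invariance under flips of high bits means
  dependence on the low bits only.
\<close>

lemma flip_invariant_cong:
  assumes inv: "\<And>i u. k \<le> i \<Longrightarrow> i < N \<Longrightarrow> \<phi> (flip_bit i u) = \<phi> u"
    and u: "u < 2 ^ N" and u': "u' < 2 ^ N" and eq: "\<forall>i<k. bit u i = bit u' i" and k: "k \<le> N"
  shows "\<phi> u = \<phi> (u' :: nat)"
proof -
  have *: "\<phi> (take_bit n v) = \<phi> (take_bit k v)" if "k \<le> n" "n \<le> N" for n v
    using that
  proof (induction n rule: dec_induct)
    case (step n)
    have "take_bit (Suc n) v = (if bit v n then flip_bit n (take_bit n v) else take_bit n v)"
      by (rule bit_eqI) (auto simp: bit_take_bit_iff bit_flip_bit_iff less_Suc_eq)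
    hence "\<phi> (take_bit (Suc n) v) = \<phi> (take_bit n v)"
      using inv step by auto
    thus ?case using step by simp
  qed simp
  have "take_bit k u = take_bit k u'"
    using eq by (intro bit_eqI) (auto simp: bit_take_bit_iff)
  thus ?thesis
    using *[of N u] *[of N u'] k u u' by (simp add: take_bit_nat_eq_self)
qed

text \<open>
  \<open>avg_from N d\<close> averages over the top \<open>d\<close> of \<open>N\<close> bits.  The recursion from the top down makes the tower
  property and self-adjointness of conditional expectations direct inductions.
\<close>

primrec avg_from :: "nat \<Rightarrow> nat \<Rightarrow> (nat \<Rightarrow> real) \<Rightarrow> nat \<Rightarrow> real" where
  "avg_from N 0 g = g"
| "avg_from N (Suc d) g = (\<lambda>u. (avg_from N d g u + avg_from N d g (flip_bit (N - Suc d) u)) / 2)"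

definition cond_avg :: "nat \<Rightarrow> nat \<Rightarrow> (nat \<Rightarrow> real) \<Rightarrow> nat \<Rightarrow> real" where
  "cond_avg N k = avg_from N (N - k)"

lemma cond_avg_top: "N \<le> k \<Longrightarrow> cond_avg N k g = g"
  by (simp add: cond_avg_def)

lemma cond_avg_step:
  assumes "k < N"
  shows "cond_avg N k g u = (cond_avg N (Suc k) g u + cond_avg N (Suc k) g (flip_bit k u)) / 2"
proof -
  have "N - k = Suc (N - Suc k)" "N - Suc (N - Suc k) = k" using assms by auto
  thus ?thesis unfolding cond_avg_def by simp
qed

lemma avg_from_mono: "(\<And>u. g u \<le> h u) \<Longrightarrow> avg_from N d g u \<le> avg_from N d h u"
  by (induction d arbitrary: u) (auto intro!: divide_right_mono add_mono)

lemma cond_avg_mono: "(\<And>u. g u \<le> h u) \<Longrightarrow> cond_avg N k g u \<le> cond_avg N k h u"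
  unfolding cond_avg_def by (rule avg_from_mono)

lemma cond_avg_nonneg: "(\<And>u. 0 \<le> g u) \<Longrightarrow> 0 \<le> cond_avg N k g u"
proof -
  have "avg_from N d (\<lambda>u. 0) u = 0" for d u by (induction d arbitrary: u) auto
  thus "(\<And>u. 0 \<le> g u) \<Longrightarrow> 0 \<le> cond_avg N k g u"
    using cond_avg_mono[of "\<lambda>u. 0" g N k u] by (simp add: cond_avg_def)
qed

lemma cond_avg_flip:
  assumes "k \<le> i" "i < N"
  shows "cond_avg N k g (flip_bit i u) = cond_avg N k g u"
proof -
  have "k \<le> N" using assms by auto
  hence "k \<le> i \<longrightarrow> (\<forall>u. cond_avg N k g (flip_bit i u) = cond_avg N k g u)"
  proof (induction k rule: inc_induct)
    case (step k)
    show ?case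
    proof (intro impI allI)
      fix u assume "k \<le> i"
      show "cond_avg N k g (flip_bit i u) = cond_avg N k g u"
      proof (cases "k = i")
        case True
        thus ?thesis using step(2) by (simp add: cond_avg_step add.commute)
      next
        case False
        hence "cond_avg N (Suc k) g (flip_bit i u) = cond_avg N (Suc k) g u" for u
          using step(3) \<open>k \<le> i\<close> by auto
        thus ?thesis using step(2) by (simp add: cond_avg_step flip_bit_commute[of k i])
      qed
    qed
  qed (use assms in auto)
  thus ?thesis using assms by simp
qed

lemma sum_mult_cond_avg:
  assumes k: "k \<le> N" and inv: "\<And>i u. k \<le> i \<Longrightarrow> i < N \<Longrightarrow> f (flip_bit i u) = f u"
  shows "(\<Sum>u<2^N. f u * cond_avg N k g u) = (\<Sum>u<2^N. f u * g u)"
proof -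
  have "(\<Sum>u<2^N. f u * cond_avg N j g u) = (\<Sum>u<2^N. f u * g u)" if "k \<le> j" "j \<le> N" for j
    using that(2,1)
  proof (induction j rule: inc_induct)
    case (step j)
    have "(\<Sum>u<2^N. f u * cond_avg N j g u) = (\<Sum>u<2^N. (f u * cond_avg N (Suc j) g u
        + f (flip_bit j u) * cond_avg N (Suc j) g (flip_bit j u)) / 2)"
      using step by (intro sum.cong) (simp_all add: cond_avg_step inv field_simps)
    also have "\<dots> = (\<Sum>u<2^N. f u * cond_avg N (Suc j) g u)"
      using step(2) by (rule sum_flip_average)
    finally show ?case using step by simp
  qed (simp add: cond_avg_top)
  thus ?thesis using k by simp
qed

definition max_avg :: "nat \<Rightarrow> (nat \<Rightarrow> real) \<Rightarrow> nat \<Rightarrow> real" where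
  "max_avg N g u = runmax (\<lambda>k. cond_avg N k g u) N"

lemma cond_avg_le_max_avg: "k \<le> N \<Longrightarrow> cond_avg N k g u \<le> max_avg N g u"
  unfolding max_avg_def by (rule le_runmax)

lemma max_avg_nonneg: "(\<And>u. 0 \<le> g u) \<Longrightarrow> 0 \<le> max_avg N g u"
  unfolding max_avg_def by (intro runmax_nonneg cond_avg_nonneg)

lemma sum_max_avg_powr:
  assumes "1 < q"
  shows "\<exists>C\<ge>0. \<forall>N g. (\<forall>u. 0 \<le> g u) \<longrightarrow>
    (\<Sum>u<2^N. max_avg N g u powr q) \<le> C * (\<Sum>u<2^N. g u powr q)"
proof -
  obtain C where C: "C \<ge> 0" "\<And>N s. dyadic_submartingale N s \<Longrightarrow>
      (\<Sum>u<2^N. runmax (\<lambda>k. s k u) N powr q) \<le> C * (\<Sum>u<2^N. s N u powr q)"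
    using doob_maximal_inequality[OF assms] by auto
  have "(\<Sum>u<2^N. max_avg N g u powr q) \<le> C * (\<Sum>u<2^N. g u powr q)" if "\<forall>u. 0 \<le> g u" for N g
  proof -
    have "dyadic_submartingale N (\<lambda>k. cond_avg N k g)"
      unfolding dyadic_submartingale_def
    proof (intro conjI allI impI)
      show "2 * cond_avg N k g u \<le> cond_avg N (Suc k) g u + cond_avg N (Suc k) g (flip_bit k u)"
        if "k < N" for k u
        unfolding cond_avg_step[OF that] by simp
    qed (use that in \<open>simp_all add: cond_avg_nonneg cond_avg_flip\<close>)
    from C(2)[OF this] show ?thesis by (simp add: max_avg_def cond_avg_top)
  qed
  thus ?thesis using C(1) by blast
qed

text \<open>
  \<open>cond_avg2\<close> averages over dyadic rectangles of the point grid.  Instead of their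
  maximum, \<open>strong_max\<close> is the larger iterate of the one-parameter maximal functions, so that its
  boundedness on \<open>L\<^sup>q\<close>, \<open>q > 1\<close>, follows one variable at a time.
\<close>

definition cond_avg2 :: "nat \<Rightarrow> nat \<Rightarrow> nat \<Rightarrow> (nat \<times> nat \<Rightarrow> real) \<Rightarrow> nat \<times> nat \<Rightarrow> real" where
  "cond_avg2 N k l g x = cond_avg N k (\<lambda>u. cond_avg N l (\<lambda>v. g (u, v)) (snd x)) (fst x)"

definition strong_max :: "nat \<Rightarrow> (nat \<times> nat \<Rightarrow> real) \<Rightarrow> nat \<times> nat \<Rightarrow> real" where
  "strong_max N g x = max_avg N (\<lambda>u. max_avg N (\<lambda>v. g (u, v)) (snd x)) (fst x)"

lemma strong_max_nonneg: "(\<And>x. 0 \<le> g x) \<Longrightarrow> 0 \<le> strong_max N g x"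
  unfolding strong_max_def by (intro max_avg_nonneg)

lemma cond_avg2_nonneg: "(\<And>x. 0 \<le> g x) \<Longrightarrow> 0 \<le> cond_avg2 N k l g x"
  unfolding cond_avg2_def by (intro cond_avg_nonneg)

lemma cond_avg2_le_strong_max:
  assumes "k \<le> N" "l \<le> N"
  shows "cond_avg2 N k l g x \<le> strong_max N g x"
proof -
  have "cond_avg2 N k l g x \<le> cond_avg N k (\<lambda>u. max_avg N (\<lambda>v. g (u, v)) (snd x)) (fst x)"
    unfolding cond_avg2_def using assms by (intro cond_avg_mono cond_avg_le_max_avg)
  also have "\<dots> \<le> strong_max N g x"
    unfolding strong_max_def using assms by (intro cond_avg_le_max_avg)
  finally show ?thesis .
qed

lemma cond_avg2_cong:
  assumes "k \<le> N" "l \<le> N" "x \<in> grid N" "y \<in> grid N"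
    "\<forall>i<k. bit (fst y) i = bit (fst x) i" "\<forall>i<l. bit (snd y) i = bit (snd x) i"
  shows "cond_avg2 N k l g y = cond_avg2 N k l g x"
proof -
  have "cond_avg N l (\<lambda>v. g (u, v)) (snd y) = cond_avg N l (\<lambda>v. g (u, v)) (snd x)" for u
    by (rule flip_invariant_cong[where k = l and N = N])
       (use assms in \<open>auto simp: grid_def cond_avg_flip\<close>)
  hence "cond_avg2 N k l g y = cond_avg N k (\<lambda>u. cond_avg N l (\<lambda>v. g (u, v)) (snd x)) (fst y)"
    by (simp add: cond_avg2_def)
  also have "\<dots> = cond_avg2 N k l g x"
    unfolding cond_avg2_def
    by (rule flip_invariant_cong[where k = k and N = N])
       (use assms in \<open>auto simp: grid_def cond_avg_flip\<close>)
  finally show ?thesis .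
qed

lemma sum_mult_cond_avg2:
  assumes "k \<le> N" "l \<le> N"
    and inv1: "\<And>i u v. k \<le> i \<Longrightarrow> i < N \<Longrightarrow> f (flip_bit i u, v) = f (u, v)"
    and inv2: "\<And>i u v. l \<le> i \<Longrightarrow> i < N \<Longrightarrow> f (u, flip_bit i v) = f (u, v)"
  shows "(\<Sum>x\<in>grid N. f x * cond_avg2 N k l g x) = (\<Sum>x\<in>grid N. f x * g x)"
proof -
  have "(\<Sum>x\<in>grid N. f x * cond_avg2 N k l g x)
      = (\<Sum>v<2^N. \<Sum>u<2^N. f (u, v) * cond_avg N l (\<lambda>v. g (u, v)) v)"
    unfolding sum_grid_swap cond_avg2_def fst_conv snd_conv using assms(1) inv1
    by (intro sum.cong refl sum_mult_cond_avg) auto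
  also have "\<dots> = (\<Sum>u<2^N. \<Sum>v<2^N. f (u, v) * cond_avg N l (\<lambda>v. g (u, v)) v)"
    by (rule sum.swap)
  also have "\<dots> = (\<Sum>x\<in>grid N. f x * g x)"
    unfolding sum_grid using assms(2) inv2 by (intro sum.cong refl sum_mult_cond_avg) auto
  finally show ?thesis .
qed

lemma sum_strong_max_powr:
  assumes "1 < q"
  shows "\<exists>C\<ge>0. \<forall>N g. (\<forall>x. 0 \<le> g x) \<longrightarrow>
    (\<Sum>x\<in>grid N. strong_max N g x powr q) \<le> C * (\<Sum>x\<in>grid N. g x powr q)"
proof -
  obtain C where C: "C \<ge> 0" "\<And>N g. (\<forall>u. 0 \<le> g u) \<Longrightarrow>
      (\<Sum>u<2^N. max_avg N g u powr q) \<le> C * (\<Sum>u<2^N. g u powr q)"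
    using sum_max_avg_powr[OF assms] by auto
  have "(\<Sum>x\<in>grid N. strong_max N g x powr q) \<le> (C * C) * (\<Sum>x\<in>grid N. g x powr q)"
    if g: "\<forall>x. 0 \<le> g x" for N g
  proof -
    have "(\<Sum>x\<in>grid N. strong_max N g x powr q)
        \<le> (\<Sum>v<2^N. C * (\<Sum>u<2^N. max_avg N (\<lambda>v. g (u, v)) v powr q))"
      unfolding sum_grid_swap strong_max_def fst_conv snd_conv using g
      by (intro sum_mono C(2)) (auto intro: max_avg_nonneg)
    also have "\<dots> = C * (\<Sum>u<2^N. \<Sum>v<2^N. max_avg N (\<lambda>v. g (u, v)) v powr q)"
      unfolding sum_distrib_left by (rule sum.swap)
    also have "\<dots> \<le> C * (\<Sum>u<2^N. C * (\<Sum>v<2^N. g (u, v) powr q))"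
      using g C(1) by (intro mult_left_mono sum_mono C(2)) auto
    also have "\<dots> = (C * C) * (\<Sum>x\<in>grid N. g x powr q)"
      by (simp add: sum_grid sum_distrib_left mult.assoc)
    finally show ?thesis .
  qed
  moreover have "0 \<le> C * C" by simp
  ultimately show ?thesis by blast
qed

section \<open>Disjoint dyadic rectangles\<close>

text \<open>
  Writing \<open>lam i\<close> and \<open>m j\<close> as integrals of the indicators of \<open>{t. t < lam i}\<close> and \<open>{t. t < m j}\<close> reduces a
  comparison of weighted sums to a comparison on every level set.
\<close>

lemma layer_cake_sum:
  fixes a lam :: "'i \<Rightarrow> real" and b m :: "'j \<Rightarrow> real"
  assumes "finite A" "finite B"
    and nn: "\<And>i. i \<in> A \<Longrightarrow> 0 \<le> a i" "\<And>i. i \<in> A \<Longrightarrow> 0 \<le> lam i"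
      "\<And>j. j \<in> B \<Longrightarrow> 0 \<le> b j" "\<And>j. j \<in> B \<Longrightarrow> 0 \<le> m j"
    and le: "\<And>t. 0 \<le> t \<Longrightarrow> (\<Sum>i\<in>A. if t < lam i then a i else 0) \<le> (\<Sum>j\<in>B. if t < m j then b j else 0)"
  shows "(\<Sum>i\<in>A. a i * lam i) \<le> (\<Sum>j\<in>B. b j * m j)"
proof -
  have cake: "ennreal (\<Sum>i\<in>A. a i * lam i)
      = (\<integral>\<^sup>+t. ennreal (\<Sum>i\<in>A. if t < lam i then a i else 0) * indicator {0..} t \<partial>lborel)"
    if "finite A" "\<And>i. i \<in> A \<Longrightarrow> 0 \<le> a i" "\<And>i. i \<in> A \<Longrightarrow> 0 \<le> lam i"
    for A :: "'k set" and a lam :: "'k \<Rightarrow> real"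
  proof -
    have "(\<integral>\<^sup>+t. ennreal (\<Sum>i\<in>A. if t < lam i then a i else 0) * indicator {0..} t \<partial>lborel)
        = (\<integral>\<^sup>+t. (\<Sum>i\<in>A. ennreal (a i) * indicator {0..<lam i} t) \<partial>lborel)"
    proof (intro nn_integral_cong)
      fix t :: real
      have "ennreal (\<Sum>i\<in>A. if t < lam i then a i else 0) = (\<Sum>i\<in>A. ennreal (if t < lam i then a i else 0))"
        using that by (intro sum_ennreal[symmetric]) auto
      hence "ennreal (\<Sum>i\<in>A. if t < lam i then a i else 0) * indicator {0..} t
          = (\<Sum>i\<in>A. ennreal (if t < lam i then a i else 0) * indicator {0..} t)"
        by (simp only: sum_distrib_right)
      also have "\<dots> = (\<Sum>i\<in>A. ennreal (a i) * indicator {0..<lam i} t)"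
        by (intro sum.cong) (auto simp: indicator_def)
      finally show "ennreal (\<Sum>i\<in>A. if t < lam i then a i else 0) * indicator {0..} t
          = (\<Sum>i\<in>A. ennreal (a i) * indicator {0..<lam i} t)" .
    qed
    also have "\<dots> = (\<Sum>i\<in>A. ennreal (a i) * ennreal (lam i))"
      using that by (subst nn_integral_sum) (auto simp: nn_integral_cmult_indicator intro!: sum.cong)
    also have "\<dots> = (\<Sum>i\<in>A. ennreal (a i * lam i))"
      using that by (intro sum.cong refl ennreal_mult[symmetric]) auto
    also have "\<dots> = ennreal (\<Sum>i\<in>A. a i * lam i)"
      using that by (intro sum_ennreal) auto
    finally show ?thesis by simp
  qed
  have "ennreal (\<Sum>i\<in>A. a i * lam i) \<le> ennreal (\<Sum>j\<in>B. b j * m j)"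
  proof (subst (1 2) cake)
    show "(\<integral>\<^sup>+t. ennreal (\<Sum>i\<in>A. if t < lam i then a i else 0) * indicator {0..} t \<partial>lborel)
      \<le> (\<integral>\<^sup>+t. ennreal (\<Sum>j\<in>B. if t < m j then b j else 0) * indicator {0..} t \<partial>lborel)"
      by (intro nn_integral_mono) (auto simp: indicator_def intro!: ennreal_leI le)
  qed (use assms(1,2) nn in auto)
  thus ?thesis using nn by (subst (asm) ennreal_le_iff) (auto intro!: sum_nonneg)
qed

text \<open>
  The core of the argument.  The modulus of the multiplier of \<open>Q i\<close> is constant on dyadic rectangles, so
  the weight \<open>g\<close> may be replaced by its averages over them.  On the set where such an average exceeds
  \<open>t\<close> the strong maximal function of \<open>g\<close> exceeds \<open>t\<close> as well, and since the multipliers are local only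
  the restriction \<open>G\<close> of \<open>F\<close> to \<open>{x. t < strong_max N g x}\<close> matters there.  Bessel's inequality applied
  to \<open>G\<close> gives the estimate for every level \<open>t\<close>, simultaneously for all rectangles.
\<close>

lemma dyadic_square_sum_weighted:
  assumes T: "finite T" "disjoint_family_on Q T"
    and Q: "\<And>i. i \<in> T \<Longrightarrow> dyadic_rect N (k i) (l i) (Q i)"
    and g: "\<And>x. 0 \<le> g x"
  shows "(\<Sum>x\<in>grid N. (\<Sum>i\<in>T. (cmod (grid_mult N (Q i) F x))\<^sup>2) * g x)
    \<le> (\<Sum>x\<in>grid N. (cmod (F x))\<^sup>2 * strong_max N g x)"
proof -
  define lam where "lam z = cond_avg2 N (k (fst z)) (l (fst z)) g (snd z)" for z
  define a where "a z = (cmod (grid_mult N (Q (fst z)) F (snd z)))\<^sup>2" for z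
  have kl: "k i \<le> N" "l i \<le> N" if "i \<in> T" for i
    using Q[OF that] by (auto simp: dyadic_rect_def)
  have "(\<Sum>x\<in>grid N. (\<Sum>i\<in>T. (cmod (grid_mult N (Q i) F x))\<^sup>2) * g x)
      = (\<Sum>i\<in>T. \<Sum>x\<in>grid N. (cmod (grid_mult N (Q i) F x))\<^sup>2 * g x)"
    unfolding sum_distrib_right by (rule sum.swap)
  also have "\<dots> = (\<Sum>i\<in>T. \<Sum>x\<in>grid N. (cmod (grid_mult N (Q i) F x))\<^sup>2 * cond_avg2 N (k i) (l i) g x)"
    using kl cmod_mult_dyadic_flip[OF Q]
    by (intro sum.cong refl sum_mult_cond_avg2[symmetric]) auto
  also have "\<dots> = (\<Sum>z\<in>T \<times> grid N. a z * lam z)"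
    unfolding sum.cartesian_product' a_def lam_def fst_conv snd_conv ..
  also have "\<dots> \<le> (\<Sum>x\<in>grid N. (cmod (F x))\<^sup>2 * strong_max N g x)"
  proof (rule layer_cake_sum)
    fix t :: real assume "0 \<le> t"
    define G where "G x = (if t < strong_max N g x then F x else 0)" for x
    have "(\<Sum>z\<in>T \<times> grid N. if t < lam z then a z else 0)
        = (\<Sum>i\<in>T. \<Sum>x\<in>grid N. if t < cond_avg2 N (k i) (l i) g x then (cmod (grid_mult N (Q i) F x))\<^sup>2 else 0)"
      unfolding sum.cartesian_product' a_def lam_def fst_conv snd_conv ..
    also have "\<dots> \<le> (\<Sum>i\<in>T. \<Sum>x\<in>grid N. (cmod (grid_mult N (Q i) G x))\<^sup>2)"
    proof (intro sum_mono)
      fix i x assume i: "i \<in> T" and x: "x \<in> grid N"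
      show "(if t < cond_avg2 N (k i) (l i) g x then (cmod (grid_mult N (Q i) F x))\<^sup>2 else 0)
          \<le> (cmod (grid_mult N (Q i) G x))\<^sup>2"
      proof (cases "t < cond_avg2 N (k i) (l i) g x")
        case True
        have "grid_mult N (Q i) F x = grid_mult N (Q i) G x"
        proof (rule mult_dyadic_local[OF Q[OF i]])
          fix y assume y: "y \<in> grid N" "\<forall>j<k i. bit (fst y) j = bit (fst x) j"
            "\<forall>j<l i. bit (snd y) j = bit (snd x) j"
          have "t < cond_avg2 N (k i) (l i) g y"
            using True cond_avg2_cong[OF kl[OF i] x y] by simp
          also have "\<dots> \<le> strong_max N g y" using kl[OF i] by (rule cond_avg2_le_strong_max)
          finally show "F y = G y" by (simp add: G_def)
        qed
        thus ?thesis by simp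
      qed simp
    qed
    also have "\<dots> \<le> (\<Sum>x\<in>grid N. (cmod (G x))\<^sup>2)"
      using T Q by (intro bessel_mult) (auto simp: dyadic_rect_def)
    also have "\<dots> = (\<Sum>x\<in>grid N. if t < strong_max N g x then (cmod (F x))\<^sup>2 else 0)"
      by (intro sum.cong) (auto simp: G_def)
    finally show "(\<Sum>z\<in>T \<times> grid N. if t < lam z then a z else 0)
      \<le> (\<Sum>x\<in>grid N. if t < strong_max N g x then (cmod (F x))\<^sup>2 else 0)" .
  qed (use T g in \<open>auto simp: a_def lam_def strong_max_nonneg cond_avg2_nonneg\<close>)
  finally show ?thesis .
qed

text \<open>
  Duality by hand: with \<open>S\<close> the square of the square function, the weight \<open>g = S powr (p / 2 - 1)\<close> turns
  the weighted bound into one for the sum of \<open>S powr (p / 2)\<close>.  The conjugate exponent \<open>q\<close> of \<open>p / 2\<close>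
  satisfies \<open>g powr q = S powr (p / 2)\<close>, so the maximal term can be absorbed.  For \<open>p = 2\<close> there is no such
  \<open>q\<close>, and Bessel's inequality suffices.
\<close>

lemma dyadic_square_function:
  fixes p :: real
  assumes p: "2 \<le> p"
  shows "\<exists>C\<ge>0. \<forall>N (T :: 'i set) Q k l F. finite T \<longrightarrow> disjoint_family_on Q T \<longrightarrow>
    (\<forall>i\<in>T. dyadic_rect N (k i) (l i) (Q i)) \<longrightarrow>
    (\<Sum>x\<in>grid N. (\<Sum>i\<in>T. (cmod (grid_mult N (Q i) F x))\<^sup>2) powr (p / 2))
      \<le> C * (\<Sum>x\<in>grid N. cmod (F x) powr p)"
proof (cases "p = 2")
  case True
  have "(\<Sum>x\<in>grid N. (\<Sum>i\<in>T. (cmod (grid_mult N (Q i) F x))\<^sup>2) powr (p / 2))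
      \<le> 1 * (\<Sum>x\<in>grid N. cmod (F x) powr p)"
    if "finite T" "disjoint_family_on Q T" "\<forall>i\<in>T. dyadic_rect N (k i) (l i) (Q i)"
    for N Q k l F and T :: "'i set"
  proof -
    have "(\<Sum>x\<in>grid N. (\<Sum>i\<in>T. (cmod (grid_mult N (Q i) F x))\<^sup>2) powr (p / 2))
        = (\<Sum>i\<in>T. \<Sum>x\<in>grid N. (cmod (grid_mult N (Q i) F x))\<^sup>2)"
      using True by (subst sum.swap) (simp add: sum_nonneg)
    also have "\<dots> \<le> (\<Sum>x\<in>grid N. (cmod (F x))\<^sup>2)"
      using that by (intro bessel_mult) (auto simp: dyadic_rect_def)
    finally show ?thesis using True by simp
  qed
  thus ?thesis by (intro exI[of _ 1] conjI allI impI) simp_all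
next
  case False
  hence p2: "p > 2" using p by simp
  define q where "q = p / (p - 2)"
  have "1 < q" using p2 by (simp add: q_def)
  obtain D where D: "D \<ge> 0" "\<And>N g. (\<forall>x. 0 \<le> g x) \<Longrightarrow>
    (\<Sum>x\<in>grid N. strong_max N g x powr q) \<le> D * (\<Sum>x\<in>grid N. g x powr q)"
    using sum_strong_max_powr[OF \<open>1 < q\<close>] by auto
  define e where "e = 1 / (2 * (D + 1))"
  have e0: "e > 0" using D by (simp add: e_def)
  have "e * D \<le> e * (D + 1)" using e0 by (intro mult_left_mono) auto
  also have "\<dots> = 1 / 2" unfolding e_def using D by (simp add: field_simps)
  finally have eD: "e * D \<le> 1 / 2" .
  obtain K where K: "K \<ge> 0" "\<And>x y. 0 \<le> x \<Longrightarrow> 0 \<le> y \<Longrightarrow>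
      x powr (p - 2) * y powr 2 \<le> e * x powr (p - 2 + 2) + K * y powr (p - 2 + 2)"
    using powr_mult_absorb[of "p - 2" 2 e] p e0 by auto
  have main: "(\<Sum>x\<in>grid N. (\<Sum>i\<in>T. (cmod (grid_mult N (Q i) F x))\<^sup>2) powr (p / 2))
      \<le> (2 * K) * (\<Sum>x\<in>grid N. cmod (F x) powr p)"
    if T: "finite T" "disjoint_family_on Q T" "\<forall>i\<in>T. dyadic_rect N (k i) (l i) (Q i)"
    for N Q k l F and T :: "'i set"
  proof -
    define S where "S x = (\<Sum>i\<in>T. (cmod (grid_mult N (Q i) F x))\<^sup>2)" for x
    define g where "g x = S x powr (p / 2 - 1)" for x
    define E where "E = (\<Sum>x\<in>grid N. S x powr (p / 2))"
    have S: "0 \<le> S x" for x by (simp add: S_def sum_nonneg)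
    have g: "0 \<le> g x" for x by (simp add: g_def)
    have "S x powr (p / 2) = S x * g x" for x
      using S[of x] by (cases "S x = 0") (auto simp: g_def powr_diff)
    hence "E = (\<Sum>x\<in>grid N. S x * g x)" by (simp add: E_def)
    also have "\<dots> \<le> (\<Sum>x\<in>grid N. (cmod (F x))\<^sup>2 * strong_max N g x)"
      unfolding S_def using T g by (intro dyadic_square_sum_weighted) auto
    also have "\<dots> \<le> (\<Sum>x\<in>grid N. e * strong_max N g x powr q + K * cmod (F x) powr p)"
    proof (intro sum_mono)
      fix x
      have m: "0 \<le> strong_max N g x" using g by (rule strong_max_nonneg)
      have "(strong_max N g x powr (1 / (p - 2))) powr (p - 2) * cmod (F x) powr 2
        \<le> e * (strong_max N g x powr (1 / (p - 2))) powr (p - 2 + 2) + K * cmod (F x) powr (p - 2 + 2)"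
        by (intro K(2)) auto
      thus "(cmod (F x))\<^sup>2 * strong_max N g x \<le> e * strong_max N g x powr q + K * cmod (F x) powr p"
        using m p2 by (simp add: powr_powr q_def mult.commute)
    qed
    also have "\<dots> = e * (\<Sum>x\<in>grid N. strong_max N g x powr q) + K * (\<Sum>x\<in>grid N. cmod (F x) powr p)"
      by (simp add: sum.distrib sum_distrib_left)
    also have "\<dots> \<le> e * (D * (\<Sum>x\<in>grid N. g x powr q)) + K * (\<Sum>x\<in>grid N. cmod (F x) powr p)"
      using e0 g by (intro add_right_mono mult_left_mono D(2)) auto
    also have "(\<Sum>x\<in>grid N. g x powr q) = E"
    proof -
      have "(p / 2 - 1) * q = (p - 2) / 2 * (p / (p - 2))" by (simp add: q_def diff_divide_distrib)
      also have "\<dots> = p / 2" using p2 by (simp only: times_divide_times_eq) (simp add: divide_eq_eq algebra_simps)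
      finally have "(p / 2 - 1) * q = p / 2" .
      thus ?thesis unfolding E_def g_def powr_powr by (simp only:)
    qed
    also have "e * (D * E) + K * (\<Sum>x\<in>grid N. cmod (F x) powr p)
        \<le> 1 / 2 * E + K * (\<Sum>x\<in>grid N. cmod (F x) powr p)"
      unfolding mult.assoc[symmetric] using eD
      by (intro add_right_mono mult_right_mono) (auto simp: E_def sum_nonneg)
    finally show ?thesis by (simp add: E_def S_def)
  qed
  show ?thesis
    by (intro exI[of _ "2 * K"] conjI allI impI main) (use K in auto)
qed

section \<open>Intervals as unions of dyadic shells\<close>

text \<open>
  \<open>sep n a\<close> is the length of the binary expansion of the bitwise sum of \<open>n\<close> and \<open>a\<close>: the numbers \<open>n\<close> with
  \<open>sep n a \<le> k\<close> form the dyadic interval of length \<open>2 ^ k\<close> around \<open>a\<close>, and each shell \<open>{n. sep n a = k}\<close> is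
  a dyadic interval itself.
\<close>

definition sep :: "nat \<Rightarrow> nat \<Rightarrow> nat" where
  "sep n a = (LEAST k. \<forall>i\<ge>k. bit n i = bit a i)"

lemma sep_le_iff: "sep n a \<le> k \<longleftrightarrow> (\<forall>i\<ge>k. bit n i = bit a i)"
proof
  have "n < 2 ^ (n + a)" "a < 2 ^ (n + a)"
    by (meson le_add1 le_add2 le_less_trans less_exp)+
  hence "\<forall>i\<ge>n + a. bit n i = bit a i"
    by (meson bit_less_exp not_le)
  hence "\<forall>i\<ge>sep n a. bit n i = bit a i"
    unfolding sep_def by (rule LeastI)
  thus "sep n a \<le> k \<Longrightarrow> \<forall>i\<ge>k. bit n i = bit a i" by auto
  show "\<forall>i\<ge>k. bit n i = bit a i \<Longrightarrow> sep n a \<le> k"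
    unfolding sep_def by (rule Least_le)
qed

lemma sep_eq_0_iff: "sep n a = 0 \<longleftrightarrow> n = a"
  using sep_le_iff[of n a 0] by (auto simp: bit_eq_iff)

lemma sep_eq_Suc_iff:
  "sep n a = Suc k \<longleftrightarrow> bit n k \<noteq> bit a k \<and> (\<forall>i\<ge>Suc k. bit n i = bit a i)"
proof -
  have "sep n a = Suc k \<longleftrightarrow> sep n a \<le> Suc k \<and> \<not> sep n a \<le> k" by auto
  thus ?thesis unfolding sep_le_iff by (metis le_antisym not_less_eq_eq)
qed

lemma sep_le: "n < 2 ^ N \<Longrightarrow> a < 2 ^ N \<Longrightarrow> sep n a \<le> N"
  unfolding sep_le_iff by (meson bit_less_exp not_le)

lemma less_if_top_bit:
  fixes a n :: nat
  assumes "\<not> bit a k" "bit n k" "\<forall>i\<ge>Suc k. bit n i = bit a i"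
  shows "a < n"
proof -
  have d: "drop_bit (Suc k) n = drop_bit (Suc k) a"
    using assms(3) by (intro bit_eqI) (auto simp: bit_drop_bit_eq)
  have "take_bit (Suc k) a < 2 ^ k"
    using assms(1) by (simp add: take_bit_Suc_from_most)
  also have "2 ^ k \<le> take_bit (Suc k) n"
    using assms(2) by (simp add: take_bit_Suc_from_most)
  finally have "push_bit (Suc k) (drop_bit (Suc k) a) + take_bit (Suc k) a
      < push_bit (Suc k) (drop_bit (Suc k) n) + take_bit (Suc k) n"
    unfolding d by simp
  thus ?thesis by (simp only: bits_ident)
qed

lemma less_sep_iff:
  assumes "sep n a = Suc k"
  shows "a < n \<longleftrightarrow> bit n k" "n < a \<longleftrightarrow> bit a k"
proof -
  have *: "bit n k \<noteq> bit a k" "\<forall>i\<ge>Suc k. bit n i = bit a i"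
    using assms by (auto simp: sep_eq_Suc_iff)
  show "a < n \<longleftrightarrow> bit n k" "n < a \<longleftrightarrow> bit a k"
    using less_if_top_bit[of a k n] less_if_top_bit[of n k a] * by auto
qed

text \<open>
  The two values of \<open>s\<close> stand for the lower and the upper part of the interval.  The bound on the
  centres keeps them in the same grid as the interval.
\<close>

definition interval_shells :: "nat \<Rightarrow> nat \<Rightarrow> (bool \<Rightarrow> nat) \<Rightarrow> (bool \<Rightarrow> nat set) \<Rightarrow> bool" where
  "interval_shells a b c A \<longleftrightarrow>
    (\<forall>n. n \<in> {a..b} \<longleftrightarrow> (\<exists>s. sep n (c s) \<in> A s)) \<and>
    (\<forall>n. \<not> (sep n (c True) \<in> A True \<and> sep n (c False) \<in> A False)) \<and> (\<forall>s. c s \<le> b)"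

text \<open>
  Let \<open>r\<close> be the top bit in which \<open>a < b\<close> differ.  The members of \<open>{a..b}\<close> whose bit \<open>r\<close> is \<open>0\<close> are the
  numbers \<open>n \<ge> a\<close> that agree with \<open>a\<close> from bit \<open>r\<close> on.  For \<open>sep n a = Suc k\<close> one has \<open>a < n\<close> iff bit \<open>k\<close> of
  \<open>a\<close> is \<open>0\<close>, so these \<open>n\<close> fill whole shells around \<open>a\<close>.  The members with bit \<open>r\<close> equal to \<open>1\<close> fill
  shells around \<open>b\<close>.
\<close>

lemma interval_shells_exist: "\<exists>c A. interval_shells a b c A"
proof -
  consider "b < a" | "a = b" | "a < b" by linarith
  thus ?thesis
  proof cases
    case 1
    thus ?thesis by (intro exI[of _ "\<lambda>_. 0 :: nat"] exI[of _ "\<lambda>_. {} :: nat set"])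
        (auto simp: interval_shells_def)
  next
    case 2
    thus ?thesis
      by (intro exI[of _ "\<lambda>_. a"] exI[of _ "\<lambda>s. if s then {0} else {}"]) (auto simp: interval_shells_def sep_eq_0_iff)
  next
    case 3
    then obtain r where r: "sep a b = Suc r"
      using sep_eq_0_iff[of a b] by (cases "sep a b") auto
    have ab: "bit b r" "\<not> bit a r" "\<And>i. i \<ge> Suc r \<Longrightarrow> bit a i = bit b i"
      using less_sep_iff[OF r] 3 r by (auto simp: sep_eq_Suc_iff)
    define A where "A = insert 0 {Suc k |k. k < r \<and> \<not> bit a k}"
    define B where "B = insert 0 {Suc k |k. k < r \<and> bit b k}"
    have Ar: "k \<le> r" if "k \<in> A \<or> k \<in> B" for k using that by (auto simp: A_def B_def)
    have bitA: "bit n r = bit a r" if "sep n a \<in> A" for n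
      using Ar[of "sep n a"] that sep_le_iff[of n a r] by auto
    have bitB: "bit n r = bit b r" if "sep n b \<in> B" for n
      using Ar[of "sep n b"] that sep_le_iff[of n b r] by auto
    have into: "sep n a \<in> A \<or> sep n b \<in> B" if n: "a \<le> n" "n \<le> b" for n
    proof -
      have top: "bit n i = bit a i" if "i \<ge> Suc r" for i
      proof (rule ccontr)
        assume "bit n i \<noteq> bit a i"
        hence "\<not> sep n a \<le> Suc r" using that by (auto simp: sep_le_iff)
        then obtain k where k: "sep n a = Suc k" "k \<ge> Suc r"
          by (cases "sep n a") auto
        have "sep n b = Suc k" using k ab(3) by (auto simp: sep_eq_Suc_iff)
        thus False using k n less_sep_iff[of n a k] less_sep_iff[of n b k] ab(3)[of k]
          by (auto simp: sep_eq_Suc_iff)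
      qed
      show ?thesis
      proof (cases "bit n r")
        case False
        hence "sep n a \<le> r" unfolding sep_le_iff using top ab(2)
          by (metis le_antisym not_less_eq_eq)
        hence "sep n a \<in> A"
          using less_sep_iff[of n a] n by (cases "sep n a") (auto simp: A_def)
        thus ?thesis ..
      next
        case True
        hence "sep n b \<le> r" unfolding sep_le_iff using top ab
          by (metis le_antisym not_less_eq_eq)
        hence "sep n b \<in> B"
          using less_sep_iff[of n b] n by (cases "sep n b") (auto simp: B_def sep_eq_Suc_iff)
        thus ?thesis ..
      qed
    qed
    have outA: "a \<le> n \<and> n \<le> b" if "sep n a \<in> A" for n
    proof -
      have "n < b"
        using less_if_top_bit[of n r b] bitA[OF that] ab Ar[of "sep n a"] that sep_le_iff[of n a r]
        by auto
      moreover have "a \<le> n"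
        using that less_sep_iff[of n a] by (cases "sep n a") (auto simp: A_def sep_eq_0_iff sep_eq_Suc_iff)
      ultimately show ?thesis by simp
    qed
    have outB: "a \<le> n \<and> n \<le> b" if "sep n b \<in> B" for n
    proof -
      have "a < n"
        using less_if_top_bit[of a r n] bitB[OF that] ab Ar[of "sep n b"] that sep_le_iff[of n b r]
        by auto
      moreover have "n \<le> b"
        using that less_sep_iff[of n b] by (cases "sep n b") (auto simp: B_def sep_eq_0_iff sep_eq_Suc_iff)
      ultimately show ?thesis by simp
    qed
    show ?thesis
      unfolding interval_shells_def
    proof (intro exI[of _ "\<lambda>s. if s then a else b"] exI[of _ "\<lambda>s. if s then A else B"] conjI allI)
      show "n \<in> {a..b} \<longleftrightarrow> (\<exists>s. sep n (if s then a else b) \<in> (if s then A else B))" for n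
        using into[of n] outA[of n] outB[of n] by (auto simp: ex_bool_eq)
      show "\<not> (sep n (if True then a else b) \<in> (if True then A else B) \<and>
             sep n (if False then a else b) \<in> (if False then A else B))" for n
        using bitA[of n] bitB[of n] ab by auto
      show "(if s then a else b) \<le> b" for s using 3 by auto
    qed
  qed
qed

lemma interval_shells_family:
  "\<exists>c A. \<forall>j. interval_shells (a j) (b j) (c j) (A j)"
proof -
  have "\<forall>j. \<exists>z. interval_shells (a j) (b j) (fst z) (snd z)"
    using interval_shells_exist by simp
  then obtain g where "\<forall>j. interval_shells (a j) (b j) (fst (g j)) (snd (g j))"
    by (rule choice[THEN exE])
  thus ?thesis by (intro exI[of _ "\<lambda>j. fst (g j)"] exI[of _ "\<lambda>j. snd (g j)"])
qed

lemma interval_shells_unique: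
  "interval_shells a b c A \<Longrightarrow> sep n (c s) \<in> A s \<Longrightarrow> sep n (c t) \<in> A t \<Longrightarrow> s = t"
  unfolding interval_shells_def by (cases s; cases t) auto

lemma shell_flip:
  assumes "n < 2 ^ N" "a < 2 ^ N" "i < sep n a - 1"
  shows "flip_bit i n < 2 ^ N" "sep (flip_bit i n) a = sep n a"
proof -
  obtain k where k: "sep n a = Suc k" using assms(3) by (cases "sep n a") auto
  have "i < N" using assms(3) sep_le[OF assms(1,2)] by auto
  thus "flip_bit i n < 2 ^ N" using assms(1) by (rule flip_bit_less)
  have "i < k" using k assms(3) by simp
  hence "sep (flip_bit i n) a = Suc k"
    using k by (auto simp: sep_eq_Suc_iff bit_flip_bit_iff)
  thus "sep (flip_bit i n) a = sep n a" using k by simp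
qed

lemma shell_bits:
  assumes "sep n a = sep n' a" "sep n a - 1 \<le> i"
  shows "bit n i = bit n' i"
proof (cases "sep n a")
  case 0
  hence "n = a" "n' = a" using assms(1) sep_eq_0_iff[of n a] sep_eq_0_iff[of n' a] by auto
  thus ?thesis by simp
next
  case (Suc k)
  thus ?thesis using assms sep_eq_Suc_iff[of n a k] sep_eq_Suc_iff[of n' a k]
    by (cases "i = k") auto
qed

text \<open>
  Modulation by the Walsh function of the centre \<open>a\<close> moves the shell \<open>{n. sep n a = k}\<close> to the \<open>k\<close>-th
  frequency block of the dyadic filtration.
\<close>

lemma shell_differences:
  "dyadic_differences N (\<lambda>k u. \<Sum>n | n < 2 ^ N \<and> sep n a = k. c n * of_real (wal N n u * wal N a u))"
  unfolding dyadic_differences_def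
proof (intro conjI allI impI)
  fix k i u assume "k \<le> i" "i < N"
  thus "(\<Sum>n | n < 2 ^ N \<and> sep n a = k. c n * of_real (wal N n (flip_bit i u) * wal N a (flip_bit i u)))
      = (\<Sum>n | n < 2 ^ N \<and> sep n a = k. c n * of_real (wal N n u * wal N a u))"
    using sep_le_iff[of _ a i] by (intro sum.cong) (auto simp: wal_flip)
next
  fix k u assume "k < N"
  thus "(\<Sum>n | n < 2 ^ N \<and> sep n a = Suc k. c n * of_real (wal N n (flip_bit k u) * wal N a (flip_bit k u)))
      = - (\<Sum>n | n < 2 ^ N \<and> sep n a = Suc k. c n * of_real (wal N n u * wal N a u))"
    unfolding sum_negf[symmetric] by (intro sum.cong) (auto simp: wal_flip sep_eq_Suc_iff)
qed

lemma cmod_mult_wal [simp]: "cmod (z * of_real (wal N n u)) = cmod z"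
  by (simp add: norm_mult)

text \<open>
  Modulations have modulus one, so Burkholder's inequality holds although each index \<open>j\<close> uses its own
  centre.
\<close>

lemma shell_square_function:
  fixes p :: real
  assumes "2 \<le> p"
  shows "\<exists>C\<ge>0. \<forall>N (J :: 'j set) a c. (\<forall>j\<in>J. a j < 2 ^ N) \<longrightarrow>
    (\<Sum>u<2^N. (\<Sum>j\<in>J. (cmod (\<Sum>n | n < 2 ^ N. c j n * of_real (wal N n u)))\<^sup>2) powr (p / 2))
    \<le> C * (\<Sum>u<2^N. (\<Sum>j\<in>J. \<Sum>k\<le>N.
        (cmod (\<Sum>n | n < 2 ^ N \<and> sep n (a j) = k. c j n * of_real (wal N n u)))\<^sup>2) powr (p / 2))"
proof -
  obtain C where C: "C \<ge> 0" "\<And>N (J :: 'j set) d. (\<forall>j. dyadic_differences N (d j)) \<Longrightarrow>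
      (\<Sum>u<2^N. (\<Sum>j\<in>J. (cmod (\<Sum>k\<le>N. d j k u))\<^sup>2) powr (p / 2))
      \<le> C * (\<Sum>u<2^N. (\<Sum>j\<in>J. \<Sum>k\<le>N. (cmod (d j k u))\<^sup>2) powr (p / 2))"
    using burkholder_inequality[OF assms, where ?'j = 'j] by (metis (no_types))
  have "(\<Sum>u<2^N. (\<Sum>j\<in>J. (cmod (\<Sum>n | n < 2 ^ N. c j n * of_real (wal N n u)))\<^sup>2) powr (p / 2))
    \<le> C * (\<Sum>u<2^N. (\<Sum>j\<in>J. \<Sum>k\<le>N.
        (cmod (\<Sum>n | n < 2 ^ N \<and> sep n (a j) = k. c j n * of_real (wal N n u)))\<^sup>2) powr (p / 2))"
    if a: "\<forall>j\<in>J. a j < 2 ^ N" for N a c and J :: "'j set"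
  proof -
    define d where "d j k u = (\<Sum>n | n < 2 ^ N \<and> sep n (a j) = k.
        c j n * of_real (wal N n u * wal N (a j) u))" for j k u
    have d_eq: "d j k u = (\<Sum>n | n < 2 ^ N \<and> sep n (a j) = k. c j n * of_real (wal N n u))
        * of_real (wal N (a j) u)" for j k u
      by (simp add: d_def sum_distrib_right mult.assoc)
    have d_sum: "(\<Sum>k\<le>N. d j k u) = (\<Sum>n | n < 2 ^ N. c j n * of_real (wal N n u))
        * of_real (wal N (a j) u)" if "j \<in> J" for j u
    proof -
      have "(\<Sum>k\<le>N. \<Sum>n | n \<in> {n. n < 2 ^ N} \<and> sep n (a j) = k. c j n * of_real (wal N n u))
        = (\<Sum>n | n < 2 ^ N. c j n * of_real (wal N n u))"
        using a that by (intro sum.group) (auto intro: sep_le)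
      thus ?thesis by (simp add: d_eq flip: sum_distrib_right)
    qed
    have "\<forall>j. dyadic_differences N (d j)"
      unfolding d_def using shell_differences by blast
    from C(2)[OF this, of J] show ?thesis
      by (simp add: d_sum) (simp add: d_eq)
  qed
  thus ?thesis using C(1) by blast
qed

lemma mult_fst_slices:
  assumes "R \<subseteq> grid N"
  shows "grid_mult N {a \<in> R. P (fst a)} F (u, v) = (\<Sum>n | n < 2 ^ N \<and> P n.
    (\<Sum>m | m < 2 ^ N \<and> (n, m) \<in> R. grid_coef N F (n, m) * of_real (wal N m v)) * of_real (wal N n u))"
proof -
  have "{a \<in> R. P (fst a)} = Sigma {n. n < 2 ^ N \<and> P n} (\<lambda>n. {m. m < 2 ^ N \<and> (n, m) \<in> R})"
    using assms by (auto simp: grid_def)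
  hence "grid_mult N {a \<in> R. P (fst a)} F (u, v) = (\<Sum>n | n < 2 ^ N \<and> P n.
      \<Sum>m | m < 2 ^ N \<and> (n, m) \<in> R. grid_coef N F (n, m) * of_real (wal2 N (n, m) (u, v)))"
    unfolding grid_mult_def by (simp add: sum.Sigma split_def)
  thus ?thesis
    unfolding wal2_def sum_distrib_right fst_conv snd_conv of_real_mult by (simp only: mult_ac)
qed

lemma mult_snd_slices:
  assumes "R \<subseteq> grid N"
  shows "grid_mult N {a \<in> R. P (snd a)} F (u, v) = (\<Sum>m | m < 2 ^ N \<and> P m.
    (\<Sum>n | n < 2 ^ N \<and> (n, m) \<in> R. grid_coef N F (n, m) * of_real (wal N n u)) * of_real (wal N m v))"
proof -
  have "grid_mult N {a \<in> R. P (snd a)} F (u, v) = (\<Sum>(m, n) \<in> Sigma {m. m < 2 ^ N \<and> P m}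
      (\<lambda>m. {n. n < 2 ^ N \<and> (n, m) \<in> R}). grid_coef N F (n, m) * of_real (wal2 N (n, m) (u, v)))"
    unfolding grid_mult_def
    by (rule sum.reindex_bij_witness[of _ prod.swap prod.swap]) (use assms in \<open>auto simp: grid_def\<close>)
  also have "\<dots> = (\<Sum>m | m < 2 ^ N \<and> P m. \<Sum>n | n < 2 ^ N \<and> (n, m) \<in> R.
      grid_coef N F (n, m) * of_real (wal2 N (n, m) (u, v)))"
    by (rule sum.Sigma[symmetric]) auto
  finally show ?thesis
    unfolding wal2_def sum_distrib_right fst_conv snd_conv of_real_mult by (simp only: mult_ac)
qed

text \<open>
  In each variable separately, with the other one frozen, the frequencies are cut into shells.  The
  pieces become further indices of the \<open>l\<^sup>2\<close>-valued function, to which the next cut is applied.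
\<close>

lemma shell_square_function_fst:
  fixes p :: real
  assumes "2 \<le> p"
  shows "\<exists>C\<ge>0. \<forall>N (J :: 'j set) R \<alpha> F. (\<forall>j\<in>J. R j \<subseteq> grid N \<and> \<alpha> j < 2 ^ N) \<longrightarrow>
    (\<Sum>x\<in>grid N. (\<Sum>j\<in>J. (cmod (grid_mult N (R j) F x))\<^sup>2) powr (p / 2))
    \<le> C * (\<Sum>x\<in>grid N. (\<Sum>j\<in>J. \<Sum>k\<le>N.
        (cmod (grid_mult N {a \<in> R j. sep (fst a) (\<alpha> j) = k} F x))\<^sup>2) powr (p / 2))"
proof -
  obtain C where C: "C \<ge> 0" "\<forall>N (J :: 'j set) a c. (\<forall>j\<in>J. a j < 2 ^ N) \<longrightarrow>
    (\<Sum>u<2^N. (\<Sum>j\<in>J. (cmod (\<Sum>n | n < 2 ^ N. c j n * of_real (wal N n u)))\<^sup>2) powr (p / 2))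
    \<le> C * (\<Sum>u<2^N. (\<Sum>j\<in>J. \<Sum>k\<le>N.
        (cmod (\<Sum>n | n < 2 ^ N \<and> sep n (a j) = k. c j n * of_real (wal N n u)))\<^sup>2) powr (p / 2))"
    using shell_square_function[OF assms, where ?'j = 'j] by blast
  have main: "(\<Sum>x\<in>grid N. (\<Sum>j\<in>J. (cmod (grid_mult N (R j) F x))\<^sup>2) powr (p / 2))
    \<le> C * (\<Sum>x\<in>grid N. (\<Sum>j\<in>J. \<Sum>k\<le>N.
        (cmod (grid_mult N {a \<in> R j. sep (fst a) (\<alpha> j) = k} F x))\<^sup>2) powr (p / 2))"
    if h: "\<forall>j\<in>J. R j \<subseteq> grid N \<and> \<alpha> j < 2 ^ N" for N R \<alpha> F and J :: "'j set"
  proof -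
    define c where "c v j n = (\<Sum>m | m < 2 ^ N \<and> (n, m) \<in> R j. grid_coef N F (n, m) * of_real (wal N m v))" for v j n
    have 1: "grid_mult N (R j) F (u, v) = (\<Sum>n | n < 2 ^ N. c v j n * of_real (wal N n u))" if "j \<in> J" for j u v
      using mult_fst_slices[of "R j" N "\<lambda>_. True" F u v] h that by (simp add: c_def)
    have 2: "grid_mult N {a \<in> R j. sep (fst a) (\<alpha> j) = k} F (u, v)
        = (\<Sum>n | n < 2 ^ N \<and> sep n (\<alpha> j) = k. c v j n * of_real (wal N n u))" if "j \<in> J" for j k u v
      using mult_fst_slices[of "R j" N "\<lambda>n. sep n (\<alpha> j) = k" F u v] h that by (simp add: c_def)
    have "(\<Sum>v<2^N. \<Sum>u<2^N. (\<Sum>j\<in>J. (cmod (\<Sum>n | n < 2 ^ N. c v j n * of_real (wal N n u)))\<^sup>2) powr (p / 2))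
      \<le> (\<Sum>v<2^N. C * (\<Sum>u<2^N. (\<Sum>j\<in>J. \<Sum>k\<le>N.
        (cmod (\<Sum>n | n < 2 ^ N \<and> sep n (\<alpha> j) = k. c v j n * of_real (wal N n u)))\<^sup>2) powr (p / 2)))"
      using h by (intro sum_mono C(2)[rule_format]) auto
    thus ?thesis unfolding sum_grid_swap sum_distrib_left by (simp add: 1 2)
  qed
  show ?thesis by (intro exI[of _ C] conjI allI impI main C(1))
qed

lemma shell_square_function_snd:
  fixes p :: real
  assumes "2 \<le> p"
  shows "\<exists>C\<ge>0. \<forall>N (J :: 'j set) R \<beta> F. (\<forall>j\<in>J. R j \<subseteq> grid N \<and> \<beta> j < 2 ^ N) \<longrightarrow>
    (\<Sum>x\<in>grid N. (\<Sum>j\<in>J. (cmod (grid_mult N (R j) F x))\<^sup>2) powr (p / 2))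
    \<le> C * (\<Sum>x\<in>grid N. (\<Sum>j\<in>J. \<Sum>k\<le>N.
        (cmod (grid_mult N {a \<in> R j. sep (snd a) (\<beta> j) = k} F x))\<^sup>2) powr (p / 2))"
proof -
  obtain C where C: "C \<ge> 0" "\<forall>N (J :: 'j set) a c. (\<forall>j\<in>J. a j < 2 ^ N) \<longrightarrow>
    (\<Sum>u<2^N. (\<Sum>j\<in>J. (cmod (\<Sum>n | n < 2 ^ N. c j n * of_real (wal N n u)))\<^sup>2) powr (p / 2))
    \<le> C * (\<Sum>u<2^N. (\<Sum>j\<in>J. \<Sum>k\<le>N.
        (cmod (\<Sum>n | n < 2 ^ N \<and> sep n (a j) = k. c j n * of_real (wal N n u)))\<^sup>2) powr (p / 2))"
    using shell_square_function[OF assms, where ?'j = 'j] by blast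
  have main: "(\<Sum>x\<in>grid N. (\<Sum>j\<in>J. (cmod (grid_mult N (R j) F x))\<^sup>2) powr (p / 2))
    \<le> C * (\<Sum>x\<in>grid N. (\<Sum>j\<in>J. \<Sum>k\<le>N.
        (cmod (grid_mult N {a \<in> R j. sep (snd a) (\<beta> j) = k} F x))\<^sup>2) powr (p / 2))"
    if h: "\<forall>j\<in>J. R j \<subseteq> grid N \<and> \<beta> j < 2 ^ N" for N R \<beta> F and J :: "'j set"
  proof -
    define c where "c u j m = (\<Sum>n | n < 2 ^ N \<and> (n, m) \<in> R j. grid_coef N F (n, m) * of_real (wal N n u))" for u j m
    have 1: "grid_mult N (R j) F (u, v) = (\<Sum>m | m < 2 ^ N. c u j m * of_real (wal N m v))" if "j \<in> J" for j u v
      using mult_snd_slices[of "R j" N "\<lambda>_. True" F u v] h that by (simp add: c_def)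
    have 2: "grid_mult N {a \<in> R j. sep (snd a) (\<beta> j) = k} F (u, v)
        = (\<Sum>m | m < 2 ^ N \<and> sep m (\<beta> j) = k. c u j m * of_real (wal N m v))" if "j \<in> J" for j k u v
      using mult_snd_slices[of "R j" N "\<lambda>n. sep n (\<beta> j) = k" F u v] h that by (simp add: c_def)
    have "(\<Sum>u<2^N. \<Sum>v<2^N. (\<Sum>j\<in>J. (cmod (\<Sum>m | m < 2 ^ N. c u j m * of_real (wal N m v)))\<^sup>2) powr (p / 2))
      \<le> (\<Sum>u<2^N. C * (\<Sum>v<2^N. (\<Sum>j\<in>J. \<Sum>k\<le>N.
        (cmod (\<Sum>m | m < 2 ^ N \<and> sep m (\<beta> j) = k. c u j m * of_real (wal N m v)))\<^sup>2) powr (p / 2)))"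
      using h by (intro sum_mono C(2)[rule_format]) auto
    thus ?thesis unfolding sum_grid sum_distrib_left by (simp add: 1 2)
  qed
  show ?thesis by (intro exI[of _ C] conjI allI impI main C(1))
qed

section \<open>Disjoint rectangles\<close>

lemma shell_rect_dyadic:
  assumes "\<alpha> < 2 ^ N" "\<beta> < 2 ^ N" "k \<le> N" "l \<le> N"
  shows "dyadic_rect N (k - 1) (l - 1)
    {x \<in> grid N. sep (fst x) \<alpha> \<in> A \<and> sep (snd x) \<beta> \<in> B \<and> sep (fst x) \<alpha> = k \<and> sep (snd x) \<beta> = l}"
    (is "dyadic_rect N _ _ ?Q")
  unfolding dyadic_rect_def
proof (intro conjI ballI allI impI)
  fix x assume x: "x \<in> ?Q"
  show "(flip_bit i (fst x), snd x) \<in> ?Q" if "i < k - 1" for i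
    using x that assms shell_flip[of "fst x" N \<alpha> i] by (auto simp: grid_def)
  show "(fst x, flip_bit i (snd x)) \<in> ?Q" if "i < l - 1" for i
    using x that assms shell_flip[of "snd x" N \<beta> i] by (auto simp: grid_def)
  fix y assume y: "y \<in> ?Q"
  show "bit (fst x) i = bit (fst y) i" if "k - 1 \<le> i" for i
    using x y that by (intro shell_bits[of _ \<alpha>]) auto
  show "bit (snd x) i = bit (snd y) i" if "l - 1 \<le> i" for i
    using x y that by (intro shell_bits[of _ \<beta>]) auto
qed (use assms in auto)

text \<open>
  Cutting in both variables leaves products of shells, which are pairwise disjoint dyadic rectangles.
\<close>

lemma shell_rect_square_function:
  fixes p :: real
  assumes p: "2 \<le> p"
  shows "\<exists>C\<ge>0. \<forall>N (T :: 'i set) R \<alpha> \<beta> A B F.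
    finite T \<longrightarrow> disjoint_family_on R T \<longrightarrow>
    (\<forall>i\<in>T. \<alpha> i < 2 ^ N \<and> \<beta> i < 2 ^ N \<and>
      R i = {x \<in> grid N. sep (fst x) (\<alpha> i) \<in> A i \<and> sep (snd x) (\<beta> i) \<in> B i}) \<longrightarrow>
    (\<Sum>x\<in>grid N. (\<Sum>i\<in>T. (cmod (grid_mult N (R i) F x))\<^sup>2) powr (p / 2))
      \<le> C * (\<Sum>x\<in>grid N. cmod (F x) powr p)"
proof -
  obtain C1 where C1: "C1 \<ge> 0" "\<forall>N (J :: 'i set) R \<alpha> F. (\<forall>j\<in>J. R j \<subseteq> grid N \<and> \<alpha> j < 2 ^ N) \<longrightarrow>
    (\<Sum>x\<in>grid N. (\<Sum>j\<in>J. (cmod (grid_mult N (R j) F x))\<^sup>2) powr (p / 2))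
    \<le> C1 * (\<Sum>x\<in>grid N. (\<Sum>j\<in>J. \<Sum>k\<le>N.
        (cmod (grid_mult N {a \<in> R j. sep (fst a) (\<alpha> j) = k} F x))\<^sup>2) powr (p / 2))"
    using shell_square_function_fst[OF p, where ?'j = 'i] by blast
  obtain C2 where C2: "C2 \<ge> 0" "\<forall>N (J :: ('i \<times> nat) set) R \<beta> F. (\<forall>j\<in>J. R j \<subseteq> grid N \<and> \<beta> j < 2 ^ N) \<longrightarrow>
    (\<Sum>x\<in>grid N. (\<Sum>j\<in>J. (cmod (grid_mult N (R j) F x))\<^sup>2) powr (p / 2))
    \<le> C2 * (\<Sum>x\<in>grid N. (\<Sum>j\<in>J. \<Sum>k\<le>N.
        (cmod (grid_mult N {a \<in> R j. sep (snd a) (\<beta> j) = k} F x))\<^sup>2) powr (p / 2))"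
    using shell_square_function_snd[OF p, where ?'j = "'i \<times> nat"] by blast
  obtain C3 where C3: "C3 \<ge> 0" "\<forall>N (T :: (('i \<times> nat) \<times> nat) set) Q k l F.
    finite T \<longrightarrow> disjoint_family_on Q T \<longrightarrow>
    (\<forall>i\<in>T. dyadic_rect N (k i) (l i) (Q i)) \<longrightarrow>
    (\<Sum>x\<in>grid N. (\<Sum>i\<in>T. (cmod (grid_mult N (Q i) F x))\<^sup>2) powr (p / 2))
      \<le> C3 * (\<Sum>x\<in>grid N. cmod (F x) powr p)"
    using dyadic_square_function[OF p, where ?'i = "('i \<times> nat) \<times> nat"] by blast
  have main: "(\<Sum>x\<in>grid N. (\<Sum>i\<in>T. (cmod (grid_mult N (R i) F x))\<^sup>2) powr (p / 2))
      \<le> (C1 * (C2 * C3)) * (\<Sum>x\<in>grid N. cmod (F x) powr p)"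
    if T: "finite T" "disjoint_family_on R T"
      and R: "\<forall>i\<in>T. \<alpha> i < 2 ^ N \<and> \<beta> i < 2 ^ N \<and>
        R i = {x \<in> grid N. sep (fst x) (\<alpha> i) \<in> A i \<and> sep (snd x) (\<beta> i) \<in> B i}"
    for N R \<alpha> \<beta> A B F and T :: "'i set"
  proof -
    define R1 where "R1 z = {x \<in> R (fst z). sep (fst x) (\<alpha> (fst z)) = snd z}" for z
    define Q where "Q w = {x \<in> R1 (fst w). sep (snd x) (\<beta> (fst (fst w))) = snd w}" for w
    have "(\<Sum>x\<in>grid N. (\<Sum>i\<in>T. (cmod (grid_mult N (R i) F x))\<^sup>2) powr (p / 2))
      \<le> C1 * (\<Sum>x\<in>grid N. (\<Sum>i\<in>T. \<Sum>k\<le>N.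
          (cmod (grid_mult N {a \<in> R i. sep (fst a) (\<alpha> i) = k} F x))\<^sup>2) powr (p / 2))"
      using R by (intro C1(2)[rule_format]) auto
    also have "\<dots> = C1 * (\<Sum>x\<in>grid N. (\<Sum>z\<in>T \<times> {..N}. (cmod (grid_mult N (R1 z) F x))\<^sup>2) powr (p / 2))"
      unfolding sum.cartesian_product' R1_def fst_conv snd_conv ..
    also have "\<dots> \<le> C1 * (C2 * (\<Sum>x\<in>grid N. (\<Sum>z\<in>T \<times> {..N}. \<Sum>l\<le>N.
          (cmod (grid_mult N {a \<in> R1 z. sep (snd a) (\<beta> (fst z)) = l} F x))\<^sup>2) powr (p / 2)))"
      using R by (intro mult_left_mono C1(1) C2(2)[rule_format]) (auto simp: R1_def)
    also have "\<dots> = C1 * (C2 * (\<Sum>x\<in>grid N. (\<Sum>w\<in>(T \<times> {..N}) \<times> {..N}.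
          (cmod (grid_mult N (Q w) F x))\<^sup>2) powr (p / 2)))"
      unfolding sum.cartesian_product'[of _ "T \<times> {..N}"] Q_def fst_conv snd_conv ..
    also have "\<dots> \<le> C1 * (C2 * (C3 * (\<Sum>x\<in>grid N. cmod (F x) powr p)))"
    proof (intro mult_left_mono C1(1) C2(1) C3(2)[rule_format])
      show "disjoint_family_on Q ((T \<times> {..N}) \<times> {..N})"
        using T(2) unfolding disjoint_family_on_def Q_def R1_def by (auto 0 3)
      show "dyadic_rect N (snd (fst w) - 1) (snd w - 1) (Q w)" if "w \<in> (T \<times> {..N}) \<times> {..N}" for w
      proof -
        have "Q w = {x \<in> grid N. sep (fst x) (\<alpha> (fst (fst w))) \<in> A (fst (fst w))
            \<and> sep (snd x) (\<beta> (fst (fst w))) \<in> B (fst (fst w))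
            \<and> sep (fst x) (\<alpha> (fst (fst w))) = snd (fst w) \<and> sep (snd x) (\<beta> (fst (fst w))) = snd w}"
          using R that by (auto simp: Q_def R1_def)
        moreover have "\<alpha> (fst (fst w)) < 2 ^ N" "\<beta> (fst (fst w)) < 2 ^ N" "snd (fst w) \<le> N" "snd w \<le> N"
          using R that by auto
        ultimately show ?thesis by (simp only: shell_rect_dyadic)
      qed
    qed (use T in auto)
    finally show ?thesis by (simp add: mult.assoc)
  qed
  show ?thesis
    by (intro exI[of _ "C1 * (C2 * C3)"] conjI allI impI mult_nonneg_nonneg C1(1) C2(1) C3(1);
        rule main; assumption)
qed

lemma rectangle_square_function:
  fixes p :: real
  assumes p: "2 \<le> p"
  shows "\<exists>C\<ge>0. \<forall>N (J :: nat set) a b a' b' F.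
    finite J \<longrightarrow> (\<forall>j\<in>J. b j < 2 ^ N \<and> b' j < 2 ^ N) \<longrightarrow>
    disjoint_family_on (\<lambda>j. {a j..b j} \<times> {a' j..b' j}) J \<longrightarrow>
    (\<Sum>x\<in>grid N. (\<Sum>j\<in>J. (cmod (grid_mult N ({a j..b j} \<times> {a' j..b' j}) F x))\<^sup>2) powr (p / 2))
      \<le> C * (\<Sum>x\<in>grid N. cmod (F x) powr p)"
proof -
  obtain C where C: "C \<ge> 0" "\<forall>N (T :: (nat \<times> bool \<times> bool) set) R \<alpha> \<beta> A B F.
    finite T \<longrightarrow> disjoint_family_on R T \<longrightarrow>
    (\<forall>i\<in>T. \<alpha> i < 2 ^ N \<and> \<beta> i < 2 ^ N \<and>
      R i = {x \<in> grid N. sep (fst x) (\<alpha> i) \<in> A i \<and> sep (snd x) (\<beta> i) \<in> B i}) \<longrightarrow>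
    (\<Sum>x\<in>grid N. (\<Sum>i\<in>T. (cmod (grid_mult N (R i) F x))\<^sup>2) powr (p / 2))
      \<le> C * (\<Sum>x\<in>grid N. cmod (F x) powr p)"
    using shell_rect_square_function[OF p, where ?'i = "nat \<times> bool \<times> bool"] by blast
  have main: "(\<Sum>x\<in>grid N. (\<Sum>j\<in>J. (cmod (grid_mult N ({a j..b j} \<times> {a' j..b' j}) F x))\<^sup>2) powr (p / 2))
      \<le> (4 powr (p / 2) * C) * (\<Sum>x\<in>grid N. cmod (F x) powr p)"
    if J: "finite J" "\<forall>j\<in>J. b j < 2 ^ N \<and> b' j < 2 ^ N"
      and disj: "disjoint_family_on (\<lambda>j. {a j..b j} \<times> {a' j..b' j}) J"
    for N a b a' b' F and J :: "nat set"
  proof -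
    define D where "D j = {a j..b j} \<times> {a' j..b' j}" for j
    obtain c A where c: "\<And>j. interval_shells (a j) (b j) (c j) (A j)"
      using interval_shells_family[of a b] by blast
    obtain c' A' where c': "\<And>j. interval_shells (a' j) (b' j) (c' j) (A' j)"
      using interval_shells_family[of a' b'] by blast
    define T where "T = J \<times> (UNIV :: (bool \<times> bool) set)"
    define R where "R i = {x \<in> grid N. sep (fst x) (c (fst i) (fst (snd i))) \<in> A (fst i) (fst (snd i))
      \<and> sep (snd x) (c' (fst i) (snd (snd i))) \<in> A' (fst i) (snd (snd i))}" for i
    have D_R: "D j = (\<Union>z. R (j, z))" if "j \<in> J" for j
    proof -
      have "D j \<subseteq> grid N" using J(2) that by (auto simp: D_def grid_def)
      moreover have "x \<in> D j \<longleftrightarrow> (\<exists>s. sep (fst x) (c j s) \<in> A j s) \<and> (\<exists>t. sep (snd x) (c' j t) \<in> A' j t)" for x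
        using c[of j] c'[of j] by (cases x) (auto simp: D_def interval_shells_def)
      ultimately show ?thesis by (auto simp: R_def)
    qed
    have R_disj: "z = z'" if "x \<in> R (j, z)" "x \<in> R (j, z')" for x j z z'
    proof (rule prod_eqI)
      show "fst z = fst z'"
        using that by (intro interval_shells_unique[OF c[of j], of "fst x"]) (auto simp: R_def)
      show "snd z = snd z'"
        using that by (intro interval_shells_unique[OF c'[of j], of "snd x"]) (auto simp: R_def)
    qed
    have finR: "finite (R i)" for i by (simp add: R_def)
    have "disjoint_family_on R T"
      unfolding disjoint_family_on_def
    proof (intro ballI impI)
      fix i i' assume i: "i \<in> T" "i' \<in> T" "i \<noteq> i'"
      show "R i \<inter> R i' = {}"
      proof (rule ccontr)
        assume "R i \<inter> R i' \<noteq> {}"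
        then obtain x where x: "x \<in> R (fst i, snd i)" "x \<in> R (fst i', snd i')" by auto
        hence "x \<in> D (fst i)" "x \<in> D (fst i')" using D_R i by (auto simp: T_def)
        moreover have "fst i \<in> J" "fst i' \<in> J" using i by (auto simp: T_def)
        ultimately have "fst i = fst i'"
          using disj unfolding D_def[symmetric] disjoint_family_on_def by blast
        thus False using R_disj[of x "fst i" "snd i" "snd i'"] x i(3) by (simp add: prod_eq_iff)
      qed
    qed
    hence R_bound: "(\<Sum>x\<in>grid N. (\<Sum>i\<in>T. (cmod (grid_mult N (R i) F x))\<^sup>2) powr (p / 2))
        \<le> C * (\<Sum>x\<in>grid N. cmod (F x) powr p)"
    proof (intro C(2)[rule_format, where \<alpha> = "\<lambda>i. c (fst i) (fst (snd i))"
          and \<beta> = "\<lambda>i. c' (fst i) (snd (snd i))" and A = "\<lambda>i. A (fst i) (fst (snd i))"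
          and B = "\<lambda>i. A' (fst i) (snd (snd i))"])
      fix i assume "i \<in> T"
      hence "b (fst i) < 2 ^ N" "b' (fst i) < 2 ^ N" using J by (auto simp: T_def)
      thus "c (fst i) (fst (snd i)) < 2 ^ N \<and> c' (fst i) (snd (snd i)) < 2 ^ N \<and>
         R i = {x \<in> grid N. sep (fst x) (c (fst i) (fst (snd i))) \<in> A (fst i) (fst (snd i))
           \<and> sep (snd x) (c' (fst i) (snd (snd i))) \<in> A' (fst i) (snd (snd i))}"
        using c[of "fst i"] c'[of "fst i"]
        by (auto simp: R_def interval_shells_def intro: le_less_trans)
    qed (use J in \<open>auto simp: T_def\<close>)
    have pw: "(\<Sum>j\<in>J. (cmod (grid_mult N (D j) F x))\<^sup>2) \<le> 4 * (\<Sum>i\<in>T. (cmod (grid_mult N (R i) F x))\<^sup>2)" for x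
    proof -
      have "(cmod (grid_mult N (D j) F x))\<^sup>2 \<le> 4 * (\<Sum>z\<in>UNIV. (cmod (grid_mult N (R (j, z)) F x))\<^sup>2)" if "j \<in> J" for j
      proof -
        have "grid_mult N (D j) F x = (\<Sum>z\<in>UNIV. grid_mult N (R (j, z)) F x)"
          unfolding D_R[OF that] grid_mult_def
        proof (rule sum.UNION_disjoint)
          show "\<forall>z\<in>UNIV. \<forall>z'\<in>UNIV. z \<noteq> z' \<longrightarrow> R (j, z) \<inter> R (j, z') = {}"
            using R_disj by blast
        qed (use finR in auto)
        hence "(cmod (grid_mult N (D j) F x))\<^sup>2 \<le> (\<Sum>z\<in>UNIV. cmod (grid_mult N (R (j, z)) F x))\<^sup>2"
          by (simp only:) (intro power_mono norm_sum norm_ge_zero)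
        also have "\<dots> \<le> (\<Sum>z\<in>(UNIV :: (bool \<times> bool) set). (cmod (grid_mult N (R (j, z)) F x))\<^sup>2)
            * card (UNIV :: (bool \<times> bool) set)"
          by (rule sum_squared_le_sum_of_squares)
        finally show ?thesis by (simp add: mult.commute card_cartesian_product flip: UNIV_Times_UNIV)
      qed
      hence "(\<Sum>j\<in>J. (cmod (grid_mult N (D j) F x))\<^sup>2)
          \<le> (\<Sum>j\<in>J. 4 * (\<Sum>z\<in>UNIV. (cmod (grid_mult N (R (j, z)) F x))\<^sup>2))"
        by (rule sum_mono)
      also have "\<dots> = 4 * (\<Sum>i\<in>T. (cmod (grid_mult N (R i) F x))\<^sup>2)"
        unfolding T_def sum.cartesian_product' sum_distrib_left ..
      finally show ?thesis .
    qed
    have "(\<Sum>x\<in>grid N. (\<Sum>j\<in>J. (cmod (grid_mult N (D j) F x))\<^sup>2) powr (p / 2))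
      \<le> (\<Sum>x\<in>grid N. (4 * (\<Sum>i\<in>T. (cmod (grid_mult N (R i) F x))\<^sup>2)) powr (p / 2))"
      using p by (intro sum_mono powr_mono2 pw) (auto intro: sum_nonneg)
    also have "\<dots> = 4 powr (p / 2) * (\<Sum>x\<in>grid N. (\<Sum>i\<in>T. (cmod (grid_mult N (R i) F x))\<^sup>2) powr (p / 2))"
      by (simp only: powr_mult sum_distrib_left[of "4 powr (p / 2)"])
    also have "\<dots> \<le> 4 powr (p / 2) * (C * (\<Sum>x\<in>grid N. cmod (F x) powr p))"
      using R_bound by (intro mult_left_mono) auto
    finally show ?thesis by (simp add: D_def mult.assoc)
  qed
  show ?thesis
    by (intro exI[of _ "4 powr (p / 2) * C"] conjI allI impI mult_nonneg_nonneg powr_ge_zero C(1);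
        rule main; assumption)
qed

section \<open>Binary digits of points of the unit interval\<close>

lemma real_digit_01: "real_digit x k = 0 \<or> real_digit x k = 1"
  unfolding real_digit_def by (cases "\<lfloor>2 ^ k * x\<rfloor> mod 2 = 0") auto

definition cell :: "nat \<Rightarrow> nat \<Rightarrow> real set" where
  "cell M r = {x \<in> {0..<1}. \<forall>k<M. real_digit x (Suc k) = of_bool (bit r k)}"

lemma cell_interval: "\<exists>q::nat. cell M r = {real q / 2 ^ M..<(real q + 1) / 2 ^ M}"
proof (induction M)
  case 0
  show ?case by (rule exI[of _ 0]) (auto simp: cell_def)
next
  case (Suc M)
  then obtain q where q: "cell M r = {real q / 2 ^ M..<(real q + 1) / 2 ^ M}" by auto
  define b :: nat where "b = of_bool (bit r M)"
  have "x \<in> cell (Suc M) r \<longleftrightarrow> x \<in> {real (2 * q + b) / 2 ^ Suc M..<(real (2 * q + b) + 1) / 2 ^ Suc M}" for x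
  proof -
    define y where "y = 2 ^ Suc M * x"
    have "x \<in> cell (Suc M) r \<longleftrightarrow> x \<in> cell M r \<and> real_digit x (Suc M) = b"
      by (auto simp: cell_def less_Suc_eq b_def)
    also have "x \<in> cell M r \<longleftrightarrow> real (2 * q) \<le> y \<and> y < real (2 * q) + 2"
      unfolding q by (auto simp: y_def field_simps)
    also have "\<dots> \<and> real_digit x (Suc M) = b \<longleftrightarrow> \<lfloor>y\<rfloor> = int (2 * q + b)"
    proof -
      have "real (2 * q) \<le> y \<and> y < real (2 * q) + 2 \<longleftrightarrow> \<lfloor>y\<rfloor> = int (2 * q) \<or> \<lfloor>y\<rfloor> = int (2 * q) + 1"
        by linarith
      moreover have "real_digit x (Suc M) = nat (\<lfloor>y\<rfloor> mod 2)"
        unfolding real_digit_def y_def ..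
      ultimately show ?thesis by (auto simp: b_def)
    qed
    also have "\<dots> \<longleftrightarrow> real (2 * q + b) \<le> y \<and> y < real (2 * q + b) + 1"
      by linarith
    also have "\<dots> \<longleftrightarrow> x \<in> {real (2 * q + b) / 2 ^ Suc M..<(real (2 * q + b) + 1) / 2 ^ Suc M}"
      by (auto simp: y_def field_simps)
    finally show ?thesis .
  qed
  thus ?case by blast
qed

text \<open>
  The first \<open>2 * N\<close> binary digits of \<open>x\<close>, dealt alternately to two coordinates.  The first digit of \<open>x\<close>
  becomes the lowest bit, matching its pairing with the lowest bit of a frequency in the Walsh
  functions.
\<close>

definition address :: "nat \<Rightarrow> real \<Rightarrow> nat \<times> nat" where
  "address N x =
    (horner_sum of_bool 2 (map (\<lambda>i. real_digit x (Suc (2 * i)) = 1) [0..<N]),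
     horner_sum of_bool 2 (map (\<lambda>i. real_digit x (Suc (2 * i + 1)) = 1) [0..<N]))"

lemma bit_address:
  "bit (fst (address N x)) i \<longleftrightarrow> i < N \<and> real_digit x (Suc (2 * i)) = 1"
  "bit (snd (address N x)) i \<longleftrightarrow> i < N \<and> real_digit x (Suc (2 * i + 1)) = 1"
  by (auto simp: address_def bit_horner_sum_bit_iff)

lemma address_in_grid: "address N x \<in> grid N"
  unfolding grid_def mem_Times_iff by (auto intro!: exp_le_bits simp: bit_address)

lemma eq_iff_bits_below:
  "(n::nat) < 2 ^ N \<Longrightarrow> m < 2 ^ N \<Longrightarrow> n = m \<longleftrightarrow> (\<forall>i<N. bit n i = bit m i)"
  by (auto simp: bit_eq_iff) (metis bit_less_exp)+

lemma less_double_cases: "(\<forall>k<2 * N. P k) \<longleftrightarrow> (\<forall>i<N. P (2 * i) \<and> P (2 * i + 1 :: nat))"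
proof
  assume *: "\<forall>i<N. P (2 * i) \<and> P (2 * i + 1)"
  show "\<forall>k<2 * N. P k"
  proof (intro allI impI)
    fix k assume "k < 2 * N"
    thus "P k" using * by (cases "even k") (auto elim!: evenE oddE)
  qed
qed auto

lemma address_fiber:
  assumes "y \<in> grid N"
  shows "{x \<in> {0..<1}. address N x = y} = cell (2 * N) (interleave (fst y) (snd y))"
proof -
  have "address N x = y \<longleftrightarrow>
    (\<forall>k<2 * N. real_digit x (Suc k) = of_bool (bit (interleave (fst y) (snd y)) k))" for x
  proof -
    have "address N x = y \<longleftrightarrow> (\<forall>i<N. bit (fst (address N x)) i = bit (fst y) i) \<and>
        (\<forall>i<N. bit (snd (address N x)) i = bit (snd y) i)"
      using assms address_in_grid[of N x]
      by (simp add: prod_eq_iff grid_def mem_Times_iff eq_iff_bits_below[of _ N])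
    also have "\<dots> \<longleftrightarrow> (\<forall>i<N. real_digit x (Suc (2 * i)) = of_bool (bit (fst y) i)
        \<and> real_digit x (Suc (2 * i + 1)) = of_bool (bit (snd y) i))"
      using real_digit_01[of x] by (auto simp: bit_address of_bool_def)
    also have "\<dots> \<longleftrightarrow> (\<forall>k<2 * N. real_digit x (Suc k) = of_bool (bit (interleave (fst y) (snd y)) k))"
      unfolding less_double_cases by (simp add: bit_interleave)
    finally show ?thesis .
  qed
  thus ?thesis by (auto simp: cell_def)
qed

abbreviation unit_lebesgue :: "real measure" where
  "unit_lebesgue \<equiv> lebesgue_on {0..<1}"

text \<open>
  The address map carries Lebesgue measure to the uniform measure on the grid.
\<close>

lemma fiber_measure:
  assumes "y \<in> grid N"
  shows "{x \<in> {0..<1}. address N x = y} \<in> sets unit_lebesgue"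
    and "emeasure unit_lebesgue {x \<in> {0..<1}. address N x = y} = ennreal (1 / 4 ^ N)"
proof -
  obtain q :: nat where q: "{x \<in> {0..<1}. address N x = y} = {real q / 2 ^ (2 * N)..<(real q + 1) / 2 ^ (2 * N)}"
    using cell_interval address_fiber[OF assms] by metis
  have sub: "{x \<in> {0..<1}. address N x = y} \<subseteq> {0..<1}" by auto
  have "{x \<in> {0..<1}. address N x = y} \<in> sets lebesgue" unfolding q by simp
  thus "{x \<in> {0..<1}. address N x = y} \<in> sets unit_lebesgue"
    using sub by (simp add: sets_restrict_space_iff)
  have "emeasure unit_lebesgue {x \<in> {0..<1}. address N x = y} = emeasure lebesgue {x \<in> {0..<1}. address N x = y}"
    using sub by (intro emeasure_restrict_space) auto
  also have "\<dots> = ennreal ((real q + 1) / 2 ^ (2 * N) - real q / 2 ^ (2 * N))"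
    unfolding q by (simp add: divide_right_mono)
  also have "(real q + 1) / 2 ^ (2 * N) - real q / 2 ^ (2 * N) = 1 / 4 ^ N"
    by (simp add: diff_divide_distrib[symmetric] power_mult)
  finally show "emeasure unit_lebesgue {x \<in> {0..<1}. address N x = y} = ennreal (1 / 4 ^ N)" .
qed

lemma sum_address_indicator:
  fixes h :: "nat \<times> nat \<Rightarrow> 'a::semiring_1"
  assumes "x \<in> {0..<1}"
  shows "(\<Sum>y\<in>grid N. h y * indicator {x \<in> {0..<1}. address N x = y} x) = h (address N x)"
proof -
  have "(\<Sum>y\<in>grid N. h y * indicator {x \<in> {0..<1}. address N x = y} x)
      = (\<Sum>y\<in>grid N. if address N x = y then h y else 0)"
    using assms by (intro sum.cong) (auto simp: indicator_def)
  also have "\<dots> = h (address N x)" using address_in_grid[of N x] by simp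
  finally show ?thesis .
qed

lemma measurable_address [measurable]:
  "(\<lambda>x. h (address N x)) \<in> borel_measurable unit_lebesgue" for h :: "nat \<times> nat \<Rightarrow> ennreal"
proof -
  have [measurable]: "{x \<in> {0..<1}. address N x = y} \<in> sets unit_lebesgue" if "y \<in> grid N" for y
    using that by (rule fiber_measure)
  have "(\<lambda>x. \<Sum>y\<in>grid N. h y * indicator {x \<in> {0..<1}. address N x = y} x) \<in> borel_measurable unit_lebesgue"
    by measurable
  thus ?thesis
    by (rule measurable_cong[THEN iffD1, rotated], intro sum_address_indicator) simp
qed

lemma nn_integral_address:
  "(\<integral>\<^sup>+x. h (address N x) \<partial>unit_lebesgue) = (\<Sum>y\<in>grid N. h y * ennreal (1 / 4 ^ N))"
proof -
  have "(\<integral>\<^sup>+x. h (address N x) \<partial>unit_lebesgue)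
      = (\<integral>\<^sup>+x. (\<Sum>y\<in>grid N. h y * indicator {x \<in> {0..<1}. address N x = y} x) \<partial>unit_lebesgue)"
    by (intro nn_integral_cong sum_address_indicator[symmetric]) simp
  also have "\<dots> = (\<Sum>y\<in>grid N. h y * ennreal (1 / 4 ^ N))"
  proof (subst nn_integral_sum)
    show "(\<Sum>y\<in>grid N. \<integral>\<^sup>+x. h y * indicator {x \<in> {0..<1}. address N x = y} x \<partial>unit_lebesgue)
        = (\<Sum>y\<in>grid N. h y * ennreal (1 / 4 ^ N))"
      by (intro sum.cong refl) (simp only: nn_integral_cmult_indicator fiber_measure)
  qed (intro borel_measurable_times_ennreal borel_measurable_const borel_measurable_indicator fiber_measure(1))
  finally show ?thesis .
qed

lemma prod_lessThan_double:
  "(\<Prod>k<2 * N. g k) = (\<Prod>i<N. g (2 * i)) * (\<Prod>i<N. g (2 * i + 1))" for g :: "nat \<Rightarrow> 'a::comm_monoid_mult"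
  by (induction N) (simp_all add: mult_ac)

lemma walsh_prod:
  assumes "n < 2 ^ M"
  shows "walsh n x = (\<Prod>k<M. if bit n k \<and> real_digit x (Suc k) = 1 then -1 else 1)"
proof -
  define g :: "nat \<Rightarrow> real" where "g k = (-1) ^ (real_digit x k * nat_digit n k)" for k
  have "walsh n x = prod g {1..n}" by (simp add: walsh_def g_def)
  also have "\<dots> = prod g {1..max n M}"
    by (rule prod.mono_neutral_left) (auto simp: g_def nat_digit_eq_0)
  also have "\<dots> = prod g {1..M}"
    by (rule prod.mono_neutral_right)
       (use assms in \<open>auto simp: g_def nat_digit_def dest!: bit_less_exp\<close>)
  also have "\<dots> = (\<Prod>k<M. g (Suc k))" by (simp add: prod.atLeast1_atMost_eq)
  also have "\<dots> = (\<Prod>k<M. if bit n k \<and> real_digit x (Suc k) = 1 then -1 else 1)"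
  proof (intro prod.cong refl)
    fix k
    show "g (Suc k) = (if bit n k \<and> real_digit x (Suc k) = 1 then -1 else 1)"
      using real_digit_01[of x "Suc k"] by (auto simp: g_def nat_digit_def)
  qed
  finally show ?thesis .
qed

lemma interleave_less: "n < 2 ^ N \<Longrightarrow> m < 2 ^ N \<Longrightarrow> interleave n m < 2 ^ (2 * N)"
  by (rule exp_le_bits) (auto simp: bit_interleave split: if_splits dest!: bit_less_exp elim!: evenE oddE)

text \<open>
  Under the address map interleaving of frequencies becomes a tensor product: generalized intervals
  correspond to rectangles of a two-parameter Walsh system.
\<close>

lemma walsh_interleave:
  assumes "n < 2 ^ N" "m < 2 ^ N"
  shows "walsh (interleave n m) x = wal2 N (n, m) (address N x)"
  unfolding walsh_prod[OF interleave_less[OF assms]] prod_lessThan_double wal2_def wal_def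
  by (intro arg_cong2[of _ _ _ _ "(*)"] prod.cong) (auto simp: bit_interleave bit_address)

lemma generalized_interval_eq:
  assumes "generalized_interval I"
  obtains a b a' b' where "I = (\<lambda>(n, m). interleave n m) ` ({a..b} \<times> {a'..b'})"
proof -
  obtain l r where I: "I = {x. l \<preceq> x \<and> x \<preceq> r}"
    using assms by (auto simp: generalized_interval_def)
  obtain a a' b b' where lr: "l = interleave a a'" "r = interleave b b'"
    using bij_interleave unfolding bij_def surj_def by (metis (mono_tags) case_prod_beta)
  have "x \<in> I \<longleftrightarrow> (\<exists>n m. x = interleave n m \<and> a \<le> n \<and> n \<le> b \<and> a' \<le> m \<and> m \<le> b')" for x
    unfolding I lr preceq_def by (auto dest!: interleave_inject)
  hence "I = (\<lambda>(n, m). interleave n m) ` ({a..b} \<times> {a'..b'})" by (simp add: set_eq_iff image_iff Bex_def) blast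
  thus thesis by (rule that)
qed

section \<open>Passage from the unit interval to the grid\<close>

lemma ennreal_powr_ennreal: "0 \<le> x \<Longrightarrow> ennreal_powr (ennreal x) a = ennreal (x powr a)"
  by (simp add: ennreal_powr_def)

lemma ennreal_powr_mono:
  assumes "0 \<le> a" "s \<le> t"
  shows "ennreal_powr s a \<le> ennreal_powr t a"
proof (cases t)
  case (real r)
  then obtain r' where "s = ennreal r'" "0 \<le> r'" "r' \<le> r"
    using assms(2) by (cases s) (auto simp: top_unique)
  thus ?thesis using real assms(1) by (simp add: ennreal_powr_ennreal powr_mono2)
qed (simp add: ennreal_powr_def)

lemma ennreal_powr_powr: "ennreal_powr (ennreal_powr t a) b = ennreal_powr t (a * b)"
  by (cases t) (simp_all add: ennreal_powr_ennreal powr_powr, simp add: ennreal_powr_def)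

lemma ennreal_powr_1 [simp]: "ennreal_powr t 1 = t"
  by (cases t) (simp_all add: ennreal_powr_ennreal, simp add: ennreal_powr_def)

text \<open>
  \<open>ennreal_powr\<close> with exponent \<open>a\<close> is an order isomorphism with inverse exponent \<open>1 / a\<close>, hence commutes
  with suprema.
\<close>

lemma ennreal_powr_SUP:
  assumes "0 < a"
  shows "ennreal_powr (SUP i\<in>X. t i) a \<le> (SUP i\<in>X. ennreal_powr (t i) a)"
proof -
  define s where "s = (SUP i\<in>X. ennreal_powr (t i) a)"
  have "t i \<le> ennreal_powr s (1 / a)" if "i \<in> X" for i
  proof -
    have "t i = ennreal_powr (ennreal_powr (t i) a) (1 / a)"
      using assms by (simp add: ennreal_powr_powr)
    also have "\<dots> \<le> ennreal_powr s (1 / a)"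
      using that assms by (intro ennreal_powr_mono) (auto simp: s_def intro: SUP_upper)
    finally show ?thesis .
  qed
  hence "(SUP i\<in>X. t i) \<le> ennreal_powr s (1 / a)" by (rule SUP_least)
  hence "ennreal_powr (SUP i\<in>X. t i) a \<le> ennreal_powr (ennreal_powr s (1 / a)) a"
    using assms by (intro ennreal_powr_mono) auto
  also have "\<dots> = s" using assms by (simp add: ennreal_powr_powr)
  finally show ?thesis by (simp add: s_def)
qed

lemma infsum_ennreal_SUP:
  "(\<Sum>\<^sub>\<infinity>k\<in>K. g k) = (SUP n. \<Sum>k\<in>K \<inter> {..<n}. g k)" for g :: "nat \<Rightarrow> ennreal"
proof -
  have "infsum g K = (SUP F\<in>{F. finite F \<and> F \<subseteq> K}. sum g F)"
    by (rule nonneg_infsum_complete) simp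
  also have "\<dots> = (SUP n. \<Sum>k\<in>K \<inter> {..<n}. g k)"
  proof (rule antisym)
    show "(SUP F\<in>{F. finite F \<and> F \<subseteq> K}. sum g F) \<le> (SUP n. \<Sum>k\<in>K \<inter> {..<n}. g k)"
    proof (rule SUP_least)
      fix F assume F: "F \<in> {F. finite F \<and> F \<subseteq> K}"
      then obtain n where "F \<subseteq> {..<n}" using finite_nat_bounded[of F] by auto
      hence "sum g F \<le> sum g (K \<inter> {..<n})" using F by (intro sum_mono2) auto
      also have "\<dots> \<le> (SUP n. \<Sum>k\<in>K \<inter> {..<n}. g k)" by (rule SUP_upper) simp
      finally show "sum g F \<le> (SUP n. \<Sum>k\<in>K \<inter> {..<n}. g k)" .
    qed
    show "(SUP n. \<Sum>k\<in>K \<inter> {..<n}. g k) \<le> (SUP F\<in>{F. finite F \<and> F \<subseteq> K}. sum g F)"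
      by (rule SUP_least) (rule SUP_upper, auto)
  qed
  finally show ?thesis .
qed

lemma in_Lp_integrable:
  assumes p: "1 \<le> p" and f: "in_Lp p f"
  shows "integrable unit_lebesgue (\<lambda>x. cmod (f x) powr p)" "integrable unit_lebesgue f"
    "(\<integral>\<^sup>+x. ennreal_powr (ennreal (cmod (f x))) p \<partial>unit_lebesgue)
      = ennreal (LINT x|unit_lebesgue. cmod (f x) powr p)"
proof -
  have [measurable]: "f \<in> borel_measurable unit_lebesgue" using f by (simp add: in_Lp_def)
  have e: "(\<integral>\<^sup>+x. ennreal_powr (ennreal (cmod (f x))) p \<partial>unit_lebesgue)
      = (\<integral>\<^sup>+x. ennreal (cmod (f x) powr p) \<partial>unit_lebesgue)"
    by (simp add: ennreal_powr_ennreal)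
  have "(\<integral>\<^sup>+x. ennreal (cmod (f x) powr p) \<partial>unit_lebesgue) < \<infinity>"
    using f unfolding in_Lp_def Lp_norm_def e by (auto simp: ennreal_powr_def top.not_eq_extremum split: if_splits)
  thus i: "integrable unit_lebesgue (\<lambda>x. cmod (f x) powr p)"
    by (intro integrableI_bounded) auto
  show "(\<integral>\<^sup>+x. ennreal_powr (ennreal (cmod (f x))) p \<partial>unit_lebesgue)
      = ennreal (LINT x|unit_lebesgue. cmod (f x) powr p)"
    unfolding e using i by (rule nn_integral_eq_integral) simp
  have "emeasure unit_lebesgue (space unit_lebesgue) < \<infinity>"
    by (simp add: emeasure_restrict_space)
  hence "integrable unit_lebesgue (\<lambda>x. 1 + cmod (f x) powr p)"
    using i by (intro Bochner_Integration.integrable_add) (auto simp: finite_measure.integrable_const finite_measureI)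
  thus "integrable unit_lebesgue f"
  proof (rule Bochner_Integration.integrable_bound)
    have "cmod z \<le> 1 + cmod z powr p" for z
    proof (cases "cmod z \<le> 1")
      case False
      hence "cmod z powr 1 \<le> cmod z powr p" using p by (intro powr_mono) auto
      thus ?thesis using False by simp
    qed (use powr_ge_zero[of "cmod z" p] in linarith)
    thus "AE x in unit_lebesgue. norm (f x) \<le> norm (1 + cmod (f x) powr p)"
      by (intro AE_I2) (simp add: abs_of_nonneg)
  qed simp
qed

definition cell_average :: "nat \<Rightarrow> (real \<Rightarrow> complex) \<Rightarrow> nat \<times> nat \<Rightarrow> complex" where
  "cell_average N f y = 4 ^ N *
    (LINT x|unit_lebesgue. f x * indicator {x \<in> {0..<1}. address N x = y} x)"

lemma walsh_coeff_eq_coef: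
  assumes f: "integrable unit_lebesgue f" and nm: "n < 2 ^ N" "m < 2 ^ N"
  shows "walsh_coeff f (interleave n m) = grid_coef N (cell_average N f) (n, m)"
proof -
  let ?P = "\<lambda>y. {x \<in> {0..<1}. address N x = y}"
  have int: "integrable unit_lebesgue (\<lambda>x. f x * indicator (?P y) x)" if "y \<in> grid N" for y
  proof -
    have "(\<lambda>x. f x * indicator (?P y) x) = (\<lambda>x. indicator (?P y) x *\<^sub>R f x)"
      by (auto simp: fun_eq_iff indicator_def)
    thus ?thesis using integrable_mult_indicator[OF fiber_measure(1)[OF that] f] by simp
  qed
  have "walsh_coeff f (interleave n m)
      = (LINT x|unit_lebesgue. (\<Sum>y\<in>grid N. of_real (wal2 N (n, m) y) * (f x * indicator (?P y) x)))"
    unfolding walsh_coeff_def walsh_interleave[OF nm]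
  proof (intro Bochner_Integration.integral_cong refl)
    fix x assume "x \<in> space unit_lebesgue"
    hence "x \<in> {0..<1}" by simp
    from sum_address_indicator[OF this, of "\<lambda>y. f x * complex_of_real (wal2 N (n, m) y)" N]
    show "f x * of_real (wal2 N (n, m) (address N x))
        = (\<Sum>y\<in>grid N. of_real (wal2 N (n, m) y) * (f x * indicator (?P y) x))"
      by (simp only: mult_ac)
  qed
  also have "\<dots> = (\<Sum>y\<in>grid N. of_real (wal2 N (n, m) y) * (LINT x|unit_lebesgue. f x * indicator (?P y) x))"
    using int by (subst Bochner_Integration.integral_sum) (simp_all add: integrable_mult_right)
  also have "\<dots> = grid_coef N (cell_average N f) (n, m)"
    unfolding grid_coef_def cell_average_def sum_divide_distrib by (intro sum.cong refl) simp
  finally show ?thesis .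
qed

lemma walsh_mult_interleave:
  assumes f: "integrable unit_lebesgue f" and R: "R \<subseteq> grid N"
  shows "walsh_mult ((\<lambda>(n, m). interleave n m) ` R) f x = grid_mult N R (cell_average N f) (address N x)"
proof -
  have "inj_on (\<lambda>(n, m). interleave n m) R"
    by (auto simp: inj_on_def dest: interleave_inject)
  hence "walsh_mult ((\<lambda>(n, m). interleave n m) ` R) f x
      = (\<Sum>(n, m)\<in>R. walsh_coeff f (interleave n m) * of_real (walsh (interleave n m) x))"
    unfolding walsh_mult_def by (simp add: sum.reindex split_def)
  also have "\<dots> = grid_mult N R (cell_average N f) (address N x)"
    unfolding grid_mult_def using R
    by (intro sum.cong) (auto simp: grid_def walsh_coeff_eq_coef[OF f] walsh_interleave)
  finally show ?thesis .
qed

text \<open>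
  Jensen's inequality on one cell, obtained by integrating the tangent to \<open>t powr p\<close> at the mean \<open>c\<close> of
  \<open>cmod (f x)\<close>.
\<close>

lemma cell_average_powr_le:
  assumes p: "1 \<le> p" and f: "in_Lp p f" and y: "y \<in> grid N"
  shows "cmod (cell_average N f y) powr p
    \<le> 4 ^ N * (LINT x|unit_lebesgue. cmod (f x) powr p * indicator {x \<in> {0..<1}. address N x = y} x)"
proof -
  define P where "P = {x \<in> {0..<1}. address N x = y}"
  note i = in_Lp_integrable[OF p f]
  have P: "P \<in> sets unit_lebesgue" unfolding P_def using y by (rule fiber_measure)
  have eP: "emeasure unit_lebesgue P = ennreal (1 / 4 ^ N)"
    unfolding P_def using y by (rule fiber_measure)
  have mP: "measure unit_lebesgue (P \<inter> {0..<1}) = 1 / 4 ^ N"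
  proof -
    have "P \<inter> {0..<1} = P" by (auto simp: P_def)
    thus ?thesis using eP by (simp add: measure_def)
  qed
  have iP: "integrable unit_lebesgue (indicator P :: real \<Rightarrow> real)"
    using P eP by (intro integrable_real_indicator) auto
  have i1: "integrable unit_lebesgue (\<lambda>x. cmod (f x) * indicator P x)"
    using integrable_mult_indicator[OF P integrable_norm[OF i(2)]] by (simp add: mult.commute)
  have ip: "integrable unit_lebesgue (\<lambda>x. cmod (f x) powr p * indicator P x)"
    using integrable_mult_indicator[OF P i(1)] by (simp add: mult.commute)
  define c where "c = 4 ^ N * (LINT x|unit_lebesgue. cmod (f x) * indicator P x)"
  have "cmod (LINT x|unit_lebesgue. f x * indicator P x)
      \<le> (LINT x|unit_lebesgue. cmod (f x * indicator P x))"
    by (rule integral_norm_bound)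
  also have "(\<lambda>x. cmod (f x * indicator P x)) = (\<lambda>x. cmod (f x) * indicator P x)"
    by (auto simp: indicator_def fun_eq_iff)
  finally have le: "cmod (cell_average N f y) \<le> c"
    unfolding cell_average_def c_def P_def[symmetric] by (simp add: norm_mult norm_power)
  have c0: "0 \<le> c" using norm_ge_zero le by (rule order_trans)
  have "(LINT x|unit_lebesgue. p * c powr (p - 1) * (cmod (f x) * indicator P x))
      \<le> (LINT x|unit_lebesgue. cmod (f x) powr p * indicator P x + (p - 1) * c powr p * indicator P x)"
  proof (rule integral_mono)
    fix x
    have "p * cmod (f x) * c powr (p - 1) \<le> cmod (f x) powr p + (p - 1) * c powr p"
      using p c0 by (intro powr_tangent) auto
    thus "p * c powr (p - 1) * (cmod (f x) * indicator P x)
        \<le> cmod (f x) powr p * indicator P x + (p - 1) * c powr p * indicator P x"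
      by (auto simp: indicator_def mult_ac)
  qed (use i1 ip iP in auto)
  also have "\<dots> = (LINT x|unit_lebesgue. cmod (f x) powr p * indicator P x) + (p - 1) * c powr p * (1 / 4 ^ N)"
    using ip iP P by (subst Bochner_Integration.integral_add) (auto simp: mP)
  also have "(LINT x|unit_lebesgue. p * c powr (p - 1) * (cmod (f x) * indicator P x))
      = p * c powr (p - 1) * (c / 4 ^ N)"
    by (simp add: c_def)
  also have "p * c powr (p - 1) * (c / 4 ^ N) = p * c powr p / 4 ^ N"
    using c0 by (cases "c = 0") (auto simp: powr_diff)
  finally have "c powr p / 4 ^ N \<le> (LINT x|unit_lebesgue. cmod (f x) powr p * indicator P x)"
    by (simp add: algebra_simps diff_divide_distrib)
  hence "c powr p \<le> 4 ^ N * (LINT x|unit_lebesgue. cmod (f x) powr p * indicator P x)"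
    by (simp add: pos_divide_le_eq mult.commute)
  moreover have "cmod (cell_average N f y) powr p \<le> c powr p"
    using le p by (intro powr_mono2) auto
  ultimately show ?thesis unfolding P_def by linarith
qed

lemma sum_cell_average_powr_le:
  assumes p: "1 \<le> p" and f: "in_Lp p f"
  shows "(\<Sum>y\<in>grid N. cmod (cell_average N f y) powr p)
    \<le> 4 ^ N * (LINT x|unit_lebesgue. cmod (f x) powr p)"
proof -
  let ?P = "\<lambda>y. {x \<in> {0..<1}. address N x = y}"
  have ip: "integrable unit_lebesgue (\<lambda>x. cmod (f x) powr p * indicator (?P y) x)" if "y \<in> grid N" for y
    using integrable_mult_indicator[OF fiber_measure(1)[OF that] in_Lp_integrable(1)[OF p f]]
    by (simp add: mult.commute)
  have "(\<Sum>y\<in>grid N. cmod (cell_average N f y) powr p)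
      \<le> (\<Sum>y\<in>grid N. 4 ^ N * (LINT x|unit_lebesgue. cmod (f x) powr p * indicator (?P y) x))"
    using p f by (intro sum_mono cell_average_powr_le)
  also have "\<dots> = 4 ^ N * (LINT x|unit_lebesgue. (\<Sum>y\<in>grid N. cmod (f x) powr p * indicator (?P y) x))"
    using ip by (subst Bochner_Integration.integral_sum) (simp_all add: sum_distrib_left)
  also have "(LINT x|unit_lebesgue. (\<Sum>y\<in>grid N. cmod (f x) powr p * indicator (?P y) x))
      = (LINT x|unit_lebesgue. cmod (f x) powr p)"
    by (intro Bochner_Integration.integral_cong refl sum_address_indicator) simp
  finally show ?thesis .
qed

text \<open>
  Finitely many generalized intervals involve only frequencies below \<open>4 ^ N\<close> for some \<open>N\<close>.  Multipliers
  with such frequencies see \<open>f\<close> through its averages over the cells of length \<open>1 / 4 ^ N\<close>, so the discrete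
  estimate applies; its constant does not depend on \<open>N\<close>.
\<close>

lemma finite_square_function_bound:
  fixes p :: real
  assumes p: "2 \<le> p"
  shows "\<exists>C\<ge>0. \<forall>(K::nat set) I f. finite K \<longrightarrow> (\<forall>k\<in>K. generalized_interval (I k)) \<longrightarrow>
    disjoint_family_on I K \<longrightarrow> in_Lp p f \<longrightarrow>
    (\<lambda>x. ennreal_powr (\<Sum>k\<in>K. ennreal ((cmod (walsh_mult (I k) f x))\<^sup>2)) (p / 2))
      \<in> borel_measurable unit_lebesgue \<and>
    (\<integral>\<^sup>+x. ennreal_powr (\<Sum>k\<in>K. ennreal ((cmod (walsh_mult (I k) f x))\<^sup>2)) (p / 2) \<partial>unit_lebesgue)
      \<le> ennreal (C * (LINT x|unit_lebesgue. cmod (f x) powr p))"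
proof -
  obtain C where C: "C \<ge> 0" "\<forall>N (J :: nat set) a b a' b' F.
    finite J \<longrightarrow> (\<forall>j\<in>J. b j < 2 ^ N \<and> b' j < 2 ^ N) \<longrightarrow>
    disjoint_family_on (\<lambda>j. {a j..b j} \<times> {a' j..b' j}) J \<longrightarrow>
    (\<Sum>x\<in>grid N. (\<Sum>j\<in>J. (cmod (grid_mult N ({a j..b j} \<times> {a' j..b' j}) F x))\<^sup>2) powr (p / 2))
      \<le> C * (\<Sum>x\<in>grid N. cmod (F x) powr p)"
    using rectangle_square_function[OF p] by blast
  have main: "(\<lambda>x. ennreal_powr (\<Sum>k\<in>K. ennreal ((cmod (walsh_mult (I k) f x))\<^sup>2)) (p / 2))
      \<in> borel_measurable unit_lebesgue \<and>
    (\<integral>\<^sup>+x. ennreal_powr (\<Sum>k\<in>K. ennreal ((cmod (walsh_mult (I k) f x))\<^sup>2)) (p / 2) \<partial>unit_lebesgue)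
      \<le> ennreal (C * (LINT x|unit_lebesgue. cmod (f x) powr p))"
    if K: "finite K" "\<forall>k\<in>K. generalized_interval (I k)" "disjoint_family_on I K" and f: "in_Lp p f"
    for K :: "nat set" and I f
  proof -
    have "\<exists>z. k \<in> K \<longrightarrow> I k = (\<lambda>(n, m). interleave n m) `
        ({fst (fst z)..snd (fst z)} \<times> {fst (snd z)..snd (snd z)})" for k
      using K(2) by (metis fst_conv snd_conv generalized_interval_eq)
    then obtain z where z: "k \<in> K \<Longrightarrow> I k = (\<lambda>(n, m). interleave n m) `
        ({fst (fst (z k))..snd (fst (z k))} \<times> {fst (snd (z k))..snd (snd (z k))})" for k
      by metis
    define a b a' b' where "a k = fst (fst (z k))" and "b k = snd (fst (z k))"
      and "a' k = fst (snd (z k))" and "b' k = snd (snd (z k))" for k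
    define R where "R k = {a k..b k} \<times> {a' k..b' k}" for k
    have I: "I k = (\<lambda>(n, m). interleave n m) ` R k" if "k \<in> K" for k
      using z[OF that] by (simp add: R_def a_def b_def a'_def b'_def)
    \<comment> \<open>Any number larger than all endpoints works, as \<open>N < 2 ^ N\<close>.\<close>
    define N where "N = (\<Sum>k\<in>K. b k + b' k)"
    have bN: "b k < 2 ^ N \<and> b' k < 2 ^ N" if "k \<in> K" for k
    proof -
      have "b k + b' k \<le> N" unfolding N_def using K(1) that by (intro member_le_sum) auto
      moreover have "N < 2 ^ N" by (rule less_exp)
      ultimately show ?thesis by linarith
    qed
    have RN: "R k \<subseteq> grid N" if "k \<in> K" for k
      using bN[OF that] by (auto simp: R_def grid_def)
    have disj: "disjoint_family_on R K"
      using K(3) unfolding disjoint_family_on_def by (simp add: I) blast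
    have disj': "disjoint_family_on (\<lambda>k. {a k..b k} \<times> {a' k..b' k}) K"
      using disj unfolding disjoint_family_on_def R_def .
    define F where "F = cell_average N f"
    define h where "h y = (\<Sum>k\<in>K. (cmod (grid_mult N (R k) F y))\<^sup>2) powr (p / 2)" for y
    have fi: "integrable unit_lebesgue f" using p f by (intro in_Lp_integrable) auto
    have eq: "ennreal_powr (\<Sum>k\<in>K. ennreal ((cmod (walsh_mult (I k) f x))\<^sup>2)) (p / 2)
        = ennreal (h (address N x))" for x
      by (simp add: I walsh_mult_interleave[OF fi RN] F_def h_def sum_ennreal ennreal_powr_ennreal sum_nonneg)
    have "(\<integral>\<^sup>+x. ennreal (h (address N x)) \<partial>unit_lebesgue) = (\<Sum>y\<in>grid N. ennreal (h y) * ennreal (1 / 4 ^ N))"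
      by (rule nn_integral_address)
    also have "\<dots> = ennreal ((\<Sum>y\<in>grid N. h y) / 4 ^ N)"
      by (subst ennreal_mult[symmetric]) (auto simp: h_def sum_ennreal sum_divide_distrib)
    also have "\<dots> \<le> ennreal ((C * (4 ^ N * (LINT x|unit_lebesgue. cmod (f x) powr p))) / 4 ^ N)"
    proof (intro ennreal_leI divide_right_mono)
      have "(\<Sum>y\<in>grid N. h y) \<le> C * (\<Sum>y\<in>grid N. cmod (F y) powr p)"
        unfolding h_def R_def using K(1) bN disj'
        by (intro C(2)[rule_format]) auto
      also have "\<dots> \<le> C * (4 ^ N * (LINT x|unit_lebesgue. cmod (f x) powr p))"
        unfolding F_def using p f C(1) by (intro mult_left_mono sum_cell_average_powr_le) auto
      finally show "(\<Sum>y\<in>grid N. h y) \<le> C * (4 ^ N * (LINT x|unit_lebesgue. cmod (f x) powr p))" .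
    qed simp
    finally show ?thesis unfolding eq by (simp add: measurable_address)
  qed
  show ?thesis by (intro exI[of _ C] conjI[OF C(1)] allI impI; rule main; assumption)
qed

section \<open>The square function inequality\<close>

theorem mainTheorem6:
  fixes p :: real
  assumes "2 \<le> p"
  shows "\<exists>C::real. \<forall>(K::nat set) (I::nat \<Rightarrow> nat set) (f::real \<Rightarrow> complex).
           (\<forall>k\<in>K. generalized_interval (I k)) \<longrightarrow> disjoint_family_on I K \<longrightarrow> in_Lp p f \<longrightarrow>
           Lp_norm p (square_function K I f) \<le> ennreal C * Lp_norm p (\<lambda>x. ennreal (cmod (f x)))"
proof -
  note p = assms
  obtain C where C: "C \<ge> 0" "\<forall>(K::nat set) I f. finite K \<longrightarrow> (\<forall>k\<in>K. generalized_interval (I k)) \<longrightarrow>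
    disjoint_family_on I K \<longrightarrow> in_Lp p f \<longrightarrow>
    (\<lambda>x. ennreal_powr (\<Sum>k\<in>K. ennreal ((cmod (walsh_mult (I k) f x))\<^sup>2)) (p / 2))
      \<in> borel_measurable unit_lebesgue \<and>
    (\<integral>\<^sup>+x. ennreal_powr (\<Sum>k\<in>K. ennreal ((cmod (walsh_mult (I k) f x))\<^sup>2)) (p / 2) \<partial>unit_lebesgue)
      \<le> ennreal (C * (LINT x|unit_lebesgue. cmod (f x) powr p))"
    using finite_square_function_bound[OF p] by blast
  have "Lp_norm p (square_function K I f) \<le> ennreal (C powr (1 / p)) * Lp_norm p (\<lambda>x. ennreal (cmod (f x)))"
    if K: "\<forall>k\<in>K. generalized_interval (I k)" "disjoint_family_on I K" and f: "in_Lp p f"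
    for K :: "nat set" and I f
  proof -
    define s where "s n x = (\<Sum>k\<in>K \<inter> {..<n}. ennreal ((cmod (walsh_mult (I k) f x))\<^sup>2))" for n x
    define L where "L = (LINT x|unit_lebesgue. cmod (f x) powr p)"
    have L0: "0 \<le> L" unfolding L_def by (intro integral_nonneg_AE) auto
    have fin: "(\<lambda>x. ennreal_powr (s n x) (p / 2)) \<in> borel_measurable unit_lebesgue \<and>
        (\<integral>\<^sup>+x. ennreal_powr (s n x) (p / 2) \<partial>unit_lebesgue) \<le> ennreal (C * L)" for n
      unfolding s_def L_def using K f
      by (intro C(2)[rule_format]) (auto simp: disjoint_family_on_def)
    have "(\<integral>\<^sup>+x. ennreal_powr (square_function K I f x) p \<partial>unit_lebesgue)
        = (\<integral>\<^sup>+x. ennreal_powr (SUP n. s n x) (p / 2) \<partial>unit_lebesgue)"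
      by (simp add: square_function_def ennreal_powr_powr infsum_ennreal_SUP s_def)
    also have "\<dots> \<le> (\<integral>\<^sup>+x. (SUP n. ennreal_powr (s n x) (p / 2)) \<partial>unit_lebesgue)"
      using p by (intro nn_integral_mono ennreal_powr_SUP) auto
    also have "\<dots> = (SUP n. \<integral>\<^sup>+x. ennreal_powr (s n x) (p / 2) \<partial>unit_lebesgue)"
    proof (rule nn_integral_monotone_convergence_SUP)
      \<comment> \<open>Exhausting \<open>K\<close> by finite sets, with a constant independent of the set.\<close>
      show "incseq (\<lambda>n x. ennreal_powr (s n x) (p / 2))"
        unfolding incseq_def le_fun_def
      proof (intro allI impI)
        fix m n :: nat and x assume "m \<le> n"
        hence "s m x \<le> s n x" unfolding s_def by (intro sum_mono2) auto
        thus "ennreal_powr (s m x) (p / 2) \<le> ennreal_powr (s n x) (p / 2)"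
          using p by (intro ennreal_powr_mono) auto
      qed
    qed (use fin in auto)
    also have "\<dots> \<le> ennreal (C * L)"
      using fin by (intro SUP_least) auto
    finally have "Lp_norm p (square_function K I f) \<le> ennreal_powr (ennreal (C * L)) (1 / p)"
      unfolding Lp_norm_def using p by (intro ennreal_powr_mono) auto
    also have "\<dots> = ennreal (C powr (1 / p)) * ennreal_powr (ennreal L) (1 / p)"
      using C(1) L0 by (simp add: ennreal_powr_ennreal powr_mult flip: ennreal_mult'')
    also have "ennreal_powr (ennreal L) (1 / p) = Lp_norm p (\<lambda>x. ennreal (cmod (f x)))"
      unfolding Lp_norm_def L_def using p f by (subst in_Lp_integrable(3)) auto
    finally show ?thesis .
  qed
  thus ?thesis by blast
qed

end
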